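(* Let $N\ge1$ and $k\ge 1$ be integers. Consider the statement (S) For every finite positive definite metric space $X$ with $\#X=N$ and every sequence $(X_n)_{n\ge1}$ of finite positive definite metric spaces such that $\lim_{n\to\infty}X_n=X$ in Gromov–Hausdorff distance and $\#X_n\le k$ for all $n$, one has $\lim_{n\to\infty}|X_n|=|X|$. Then (S) is true if and only if either $k\le N+2$, or $N=1$ and $k=4$.
   Context: For a finite metric space $X=\{x_1,\dots,x_m\}$ with distance $d$, the zeta matrix is $\zeta_X=(e^{-d(x_i,x_j)})_{1\le i,j\le m}$. $X$ is positive definite if $\zeta_X$ is a positive definite matrix. The magnitude $|X|$ of a finite positive definite metric space $X$ is the sum of all entries of $\zeta_X^{-1}$. $\#X$ denotes cardinality. *)

theory Defs
  imports
    "HOL-Analysis.Abstract_Metric_Spaces"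
    "HOL-Library.Extended_Nonnegative_Real"
    "HOL-Library.Infinite_Typeclass"
    "Jordan_Normal_Form.Gauss_Jordan_Elimination"
begin

section \<open>Magnitude\<close>

text \<open>A fixed listing of the points of a finite space. The listing is arbitrary: another one
  conjugates the zeta matrix by a permutation matrix, which changes neither positive definiteness
  nor the sum of the entries of the inverse.\<close>

definition points :: "'a metric \<Rightarrow> 'a list" where
  "points X = (SOME xs. distinct xs \<and> set xs = mspace X)"

definition zeta_mat :: "'a metric \<Rightarrow> real mat" where
  "zeta_mat X = mat (card (mspace X)) (card (mspace X))
     (\<lambda>(i, j). exp (- mdist X (points X ! i) (points X ! j)))"

definition positive_definite_mat :: "real mat \<Rightarrow> bool" where
  "positive_definite_mat A \<longleftrightarrow>
     square_mat A \<and> transpose_mat A = A \<and>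
     (\<forall>v \<in> carrier_vec (dim_row A). v \<noteq> 0\<^sub>v (dim_row A) \<longrightarrow> scalar_prod v (A *\<^sub>v v) > 0)"

definition finite_posdef_space :: "'a metric \<Rightarrow> bool" where
  "finite_posdef_space X \<longleftrightarrow> finite (mspace X) \<and> positive_definite_mat (zeta_mat X)"

text \<open>Meaningful whenever the zeta matrix is invertible, in particular for positive definite
  spaces; otherwise \<open>mat_inverse\<close> is \<open>None\<close> and the value is unspecified.\<close>

definition magnitude :: "'a metric \<Rightarrow> real" where
  "magnitude X = sum_mat (the (mat_inverse (zeta_mat X)))"


section \<open>Gromov--Hausdorff distance\<close>

text \<open>Distances take values in \<open>ennreal\<close>, where an empty infimum is \<open>\<infinity>\<close> and an empty supremum
  is \<open>0\<close>; so the empty set is at infinite distance from every nonempty set.\<close>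

definition Hausdorff_dist :: "'a metric \<Rightarrow> 'a set \<Rightarrow> 'a set \<Rightarrow> ennreal" where
  "Hausdorff_dist Z A B =
     max (SUP a\<in>A. INF b\<in>B. ennreal (mdist Z a b)) (SUP b\<in>B. INF a\<in>A. ennreal (mdist Z a b))"

definition isometric_embedding :: "'a metric \<Rightarrow> 'b metric \<Rightarrow> ('a \<Rightarrow> 'b) \<Rightarrow> bool" where
  "isometric_embedding X Z f \<longleftrightarrow>
     f \<in> mspace X \<rightarrow> mspace Z \<and>
     (\<forall>x \<in> mspace X. \<forall>x' \<in> mspace X. mdist Z (f x) (f x') = mdist X x x')"

text \<open>The ambient space \<open>Z\<close> ranges over metric spaces with points in \<open>'a + 'b\<close>. This loses nothing:
  only the points of \<open>f ` mspace X \<union> g ` mspace Y\<close> matter, and this union injects into \<open>'a + 'b\<close>.\<close>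

definition GH_dist :: "'a metric \<Rightarrow> 'b metric \<Rightarrow> ennreal" where
  "GH_dist X Y =
     Inf {Hausdorff_dist Z (f ` mspace X) (g ` mspace Y) | (Z :: ('a + 'b) metric) f g.
            isometric_embedding X Z f \<and> isometric_embedding Y Z g}"

end

theory Submission
  imports Defs "Jordan_Normal_Form.Determinant"
begin

text \<open>For a positive definite space \<open>X\<close> with zeta form \<open>Q\<close>, the Cauchy--Schwarz inequality gives
  \<open>(\<Sum>v)\<^sup>2 \<le> |X| Q(v)\<close>, with equality at the weighting. Hence lower bounds on \<open>|X\<^sub>n|\<close> come from
  transporting the weighting of \<open>X\<close> to \<open>X\<^sub>n\<close>, which gives lower semicontinuity, while upper bounds come
  from lower bounds on the form of \<open>X\<^sub>n\<close>.

  If \<open>X\<^sub>n\<close> has at most two points more than \<open>X\<close>, choose a base point in each fibre of the projection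
  \<open>X\<^sub>n \<rightarrow> X\<close> and write \<open>v\<close> as a combination of point masses at base points and of differences
  \<open>e - b\<close> of an extra point and its base point. On the differences the form is diagonally dominant with
  diagonal about \<open>2 d(e, b)\<close>, and this absorbs the cross terms. If \<open>X\<close> is a point and \<open>X\<^sub>n\<close> has four points,
  \<open>X\<^sub>n\<close> embeds isometrically in the \<open>l\<^sub>1\<close> plane; then \<open>2 \<epsilon> - d\<close> is a sum of positive semidefinite
  rank-one kernels and \<open>exp (2 \<epsilon> - d) - 1\<close> is positive semidefinite by its power series, so that
  \<open>|X\<^sub>n| \<le> exp (2 \<epsilon>)\<close> where \<open>\<epsilon>\<close> bounds the diameter.

  Conversely, five points forming a cluster of three at mutual distance \<open>6 t\<close> and a cluster of two at
  distance \<open>4 t\<close>, with distance \<open>3 t\<close> between the clusters, have magnitude at least \<open>7 / 6\<close>. A 4-cycle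
  with edges of length \<open>t\<close> and an apex collapse to two points at distance \<open>ln 2\<close>, whose magnitude is
  \<open>4 / 3\<close>, but have magnitude at least \<open>3 / 2\<close>. Further points at distance \<open>ln 4\<close> from each other and from
  everything else keep this gap and give the remaining \<open>N\<close>.\<close>

section \<open>Magnitude and the zeta form\<close>

text \<open>Functions on the point set replace coordinate vectors, so the arbitrary listing
  \<open>points\<close> disappears once matrices have been translated into forms. The distance is a
  bare function, so the form also applies to explicit kernels.\<close>

definition zeta_bilin :: "'a set \<Rightarrow> ('a \<Rightarrow> 'a \<Rightarrow> real) \<Rightarrow> ('a \<Rightarrow> real) \<Rightarrow> ('a \<Rightarrow> real) \<Rightarrow> real" where
  "zeta_bilin S d u v = (\<Sum>x\<in>S. \<Sum>y\<in>S. exp (- d x y) * u x * v y)"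

definition zeta_pos :: "'a set \<Rightarrow> ('a \<Rightarrow> 'a \<Rightarrow> real) \<Rightarrow> bool" where
  "zeta_pos S d \<longleftrightarrow> (\<forall>u. (\<exists>x\<in>S. u x \<noteq> 0) \<longrightarrow> 0 < zeta_bilin S d u u)"

lemma zeta_pos_nonneg: "zeta_pos S d \<Longrightarrow> 0 \<le> zeta_bilin S d u u"
  unfolding zeta_pos_def by (cases "\<exists>x\<in>S. u x \<noteq> 0") (auto simp: zeta_bilin_def less_imp_le)

lemma zeta_bilin_commute:
  assumes "\<And>x y. x \<in> S \<Longrightarrow> y \<in> S \<Longrightarrow> d x y = d y x"
  shows "zeta_bilin S d u v = zeta_bilin S d v u"
  unfolding zeta_bilin_def
  by (subst sum.swap) (auto intro!: sum.cong simp: assms mult_ac)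

lemma zeta_bilin_add_left: "zeta_bilin S d (\<lambda>x. u x + u' x) v = zeta_bilin S d u v + zeta_bilin S d u' v"
  by (simp add: zeta_bilin_def sum.distrib[symmetric] algebra_simps)

lemma zeta_bilin_add_right: "zeta_bilin S d u (\<lambda>x. v x + v' x) = zeta_bilin S d u v + zeta_bilin S d u v'"
  by (simp add: zeta_bilin_def sum.distrib[symmetric] algebra_simps)

lemma zeta_bilin_scale_left: "zeta_bilin S d (\<lambda>x. c * u x) v = c * zeta_bilin S d u v"
  by (simp add: zeta_bilin_def sum_distrib_left algebra_simps)

lemma zeta_bilin_scale_right: "zeta_bilin S d u (\<lambda>x. c * v x) = c * zeta_bilin S d u v"
  by (simp add: zeta_bilin_def sum_distrib_left algebra_simps)

text \<open>If \<open>v\<close> solves the linear system with right-hand side \<open>g\<close>,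
  pairing with \<open>v\<close> is summation against \<open>g\<close>. The constant
  \<open>g = 1\<close> is the case of a weighting.\<close>

lemma zeta_bilin_left_eq:
  assumes "\<And>x. x \<in> S \<Longrightarrow> (\<Sum>y\<in>S. exp (- d x y) * v y) = g x"
  shows "zeta_bilin S d u v = (\<Sum>x\<in>S. u x * g x)"
proof -
  have "zeta_bilin S d u v = (\<Sum>x\<in>S. u x * (\<Sum>y\<in>S. exp (- d x y) * v y))"
    unfolding zeta_bilin_def by (simp add: sum_distrib_left mult_ac)
  then show ?thesis using assms by simp
qed

text \<open>With \<open>a = Q(u)\<close>, \<open>b = Q(u, v)\<close>, \<open>c = Q(v)\<close>, the
  form at \<open>a v - b u\<close> equals \<open>a (a c - b^2)\<close>, and \<open>a > 0\<close>
  cancels.\<close>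

lemma zeta_bilin_Cauchy_Schwarz:
  assumes pos: "zeta_pos S d" and sym: "\<And>x y. x \<in> S \<Longrightarrow> y \<in> S \<Longrightarrow> d x y = d y x"
  shows "(zeta_bilin S d u v)\<^sup>2 \<le> zeta_bilin S d u u * zeta_bilin S d v v"
proof (cases "\<exists>x\<in>S. u x \<noteq> 0")
  case False
  then have "zeta_bilin S d u v = 0" by (simp add: zeta_bilin_def)
  moreover have "zeta_bilin S d u u = 0" using False by (simp add: zeta_bilin_def)
  ultimately show ?thesis by simp
next
  case True
  define a b c where "a = zeta_bilin S d u u" "b = zeta_bilin S d u v" "c = zeta_bilin S d v v"
  have "a > 0" using pos True by (simp add: zeta_pos_def a_b_c_def)
  have "zeta_bilin S d v u = b" using zeta_bilin_commute[of S d u v] sym by (simp add: a_b_c_def)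
  moreover have "0 \<le> zeta_bilin S d (\<lambda>x. a * v x + (- b) * u x) (\<lambda>x. a * v x + (- b) * u x)"
    by (rule zeta_pos_nonneg[OF pos])
  ultimately have "0 \<le> a * (a * c - b\<^sup>2)"
    unfolding zeta_bilin_add_left zeta_bilin_add_right zeta_bilin_scale_left zeta_bilin_scale_right
    by (simp add: a_b_c_def[symmetric] algebra_simps power2_eq_square)
  then show ?thesis using \<open>a > 0\<close> by (simp add: a_b_c_def zero_le_mult_iff)
qed

section \<open>From matrices to forms: weightings and magnitude\<close>

lemma points_spec:
  assumes "finite (mspace X)"
  shows "distinct (points X)" "set (points X) = mspace X" "length (points X) = card (mspace X)"
proof -
  have "\<exists>xs. distinct xs \<and> set xs = mspace X" using finite_distinct_list[OF assms] by blast
  then have *: "distinct (points X) \<and> set (points X) = mspace X"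
    unfolding points_def by (rule someI_ex)
  then show "distinct (points X)" "set (points X) = mspace X" by auto
  then show "length (points X) = card (mspace X)" using distinct_card by fastforce
qed

lemma sum_points:
  assumes "finite (mspace X)"
  shows "(\<Sum>i\<in>{0..<card (mspace X)}. g (points X ! i)) = sum g (mspace X)"
proof (rule sum.reindex_bij_betw)
  show "bij_betw ((!) (points X)) {0..<card (mspace X)} (mspace X)"
    using points_spec[OF assms] by (simp add: bij_betw_nth lessThan_atLeast0)
qed

lemma points_coordinates:
  assumes "finite (mspace X)"
  shows "\<exists>u. \<forall>j<card (mspace X). f j = u (points X ! j)"
proof -
  have inj: "inj_on ((!) (points X)) {..<card (mspace X)}"
    using points_spec[OF assms] by (simp add: inj_on_nth)
  show ?thesis
    by (rule exI[of _ "\<lambda>x. f (the_inv_into {..<card (mspace X)} ((!) (points X)) x)"])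
       (simp add: the_inv_into_f_f[OF inj])
qed

lemma points_nth_mem: "finite (mspace X) \<Longrightarrow> j < card (mspace X) \<Longrightarrow> points X ! j \<in> mspace X"
  using points_spec[of X] nth_mem[of j "points X"] by simp

lemma points_index:
  assumes "finite (mspace X)" "x \<in> mspace X"
  obtains i where "i < card (mspace X)" "x = points X ! i"
proof -
  have "x \<in> set (points X)" using assms points_spec(2)[OF assms(1)] by simp
  then obtain i where "i < length (points X)" "x = points X ! i" by (auto simp: in_set_conv_nth)
  then show ?thesis using that points_spec(3)[OF assms(1)] by simp
qed

lemma zeta_mat_carrier: "zeta_mat X \<in> carrier_mat (card (mspace X)) (card (mspace X))"
  by (simp add: zeta_mat_def)

lemma zeta_mat_mult_vec:
  assumes "finite (mspace X)" "i < card (mspace X)"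
    and "v \<in> carrier_vec (card (mspace X))"
    and "\<And>j. j < card (mspace X) \<Longrightarrow> v $ j = u (points X ! j)"
  shows "(zeta_mat X *\<^sub>v v) $ i = (\<Sum>y\<in>mspace X. exp (- mdist X (points X ! i) y) * u y)"
proof -
  have "(zeta_mat X *\<^sub>v v) $ i = (\<Sum>j\<in>{0..<card (mspace X)}. exp (- mdist X (points X ! i) (points X ! j)) * u (points X ! j))"
    using assms(2-) by (simp add: zeta_mat_def scalar_prod_def)
  also have "\<dots> = (\<Sum>y\<in>mspace X. exp (- mdist X (points X ! i) y) * u y)"
    by (rule sum_points[OF assms(1)])
  finally show ?thesis .
qed

lemma zeta_mat_quadratic_form:
  assumes "finite (mspace X)"
    and "v \<in> carrier_vec (card (mspace X))"
    and "\<And>j. j < card (mspace X) \<Longrightarrow> v $ j = u (points X ! j)"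
  shows "v \<bullet> (zeta_mat X *\<^sub>v v) = zeta_bilin (mspace X) (mdist X) u u"
proof -
  have "v \<bullet> (zeta_mat X *\<^sub>v v) = (\<Sum>i\<in>{0..<card (mspace X)}. v $ i * (zeta_mat X *\<^sub>v v) $ i)"
    using zeta_mat_carrier[of X] by (simp add: scalar_prod_def)
  also have "\<dots> = (\<Sum>i\<in>{0..<card (mspace X)}. u (points X ! i) *
      (\<Sum>y\<in>mspace X. exp (- mdist X (points X ! i) y) * u y))"
    using assms by (intro sum.cong) (auto simp: zeta_mat_mult_vec)
  also have "\<dots> = (\<Sum>x\<in>mspace X. u x * (\<Sum>y\<in>mspace X. exp (- mdist X x y) * u y))"
    by (rule sum_points[OF assms(1)])
  also have "\<dots> = zeta_bilin (mspace X) (mdist X) u u"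
    by (rule zeta_bilin_left_eq[symmetric]) simp
  finally show ?thesis .
qed

text \<open>Squareness and symmetry hold for every zeta matrix, so only the sign of the quadratic
  form has to be translated.\<close>

lemma finite_posdef_space_iff:
  "finite_posdef_space X \<longleftrightarrow> finite (mspace X) \<and> zeta_pos (mspace X) (mdist X)"
proof (cases "finite (mspace X)")
  case fin: True
  let ?n = "card (mspace X)"
  have "square_mat (zeta_mat X)" "transpose_mat (zeta_mat X) = zeta_mat X" and dim: "dim_row (zeta_mat X) = ?n"
    by (auto simp: zeta_mat_def mdist_commute)
  then have "positive_definite_mat (zeta_mat X) \<longleftrightarrow>
      (\<forall>v \<in> carrier_vec ?n. v \<noteq> 0\<^sub>v ?n \<longrightarrow> v \<bullet> (zeta_mat X *\<^sub>v v) > 0)"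
    by (simp add: positive_definite_mat_def)
  also have "\<dots> \<longleftrightarrow> zeta_pos (mspace X) (mdist X)"
  proof
    assume L: "\<forall>v \<in> carrier_vec ?n. v \<noteq> 0\<^sub>v ?n \<longrightarrow> v \<bullet> (zeta_mat X *\<^sub>v v) > 0"
    show "zeta_pos (mspace X) (mdist X)"
      unfolding zeta_pos_def
    proof (intro allI impI)
      fix u :: "'a \<Rightarrow> real" assume "\<exists>x\<in>mspace X. u x \<noteq> 0"
      then obtain i where i: "i < ?n" "u (points X ! i) \<noteq> 0"
        using points_index[OF fin] by blast
      define v where "v = vec ?n (\<lambda>j. u (points X ! j))"
      have v: "v \<in> carrier_vec ?n" "\<And>j. j < ?n \<Longrightarrow> v $ j = u (points X ! j)" by (auto simp: v_def)
      have "v \<noteq> 0\<^sub>v ?n" using i v(2)[OF i(1)] by auto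
      then show "0 < zeta_bilin (mspace X) (mdist X) u u"
        using L v zeta_mat_quadratic_form[OF fin v] by auto
    qed
  next
    assume R: "zeta_pos (mspace X) (mdist X)"
    show "\<forall>v \<in> carrier_vec ?n. v \<noteq> 0\<^sub>v ?n \<longrightarrow> v \<bullet> (zeta_mat X *\<^sub>v v) > 0"
    proof (intro ballI impI)
      fix v :: "real vec" assume v: "v \<in> carrier_vec ?n" "v \<noteq> 0\<^sub>v ?n"
      obtain u where u: "\<And>j. j < ?n \<Longrightarrow> v $ j = u (points X ! j)"
        using points_coordinates[OF fin, of "\<lambda>j. v $ j"] by blast
      obtain i where i: "i < ?n" "v $ i \<noteq> 0"
      proof (rule ccontr)
        assume "\<not> thesis"
        then have "v = 0\<^sub>v ?n" using v(1) that by (intro eq_vecI) auto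
        with v(2) show False by simp
      qed
      then have "\<exists>x\<in>mspace X. u x \<noteq> 0"
        using u points_nth_mem[OF fin] by (intro bexI[of _ "points X ! i"]) auto
      then show "v \<bullet> (zeta_mat X *\<^sub>v v) > 0"
        using R zeta_mat_quadratic_form[OF fin v(1) u] by (auto simp: zeta_pos_def)
    qed
  qed
  finally show ?thesis by (simp add: finite_posdef_space_def fin)
qed (simp add: finite_posdef_space_def)

text \<open>A nonzero vector in the kernel would make the quadratic form vanish, so the determinant
  is nonzero and \<open>mat_inverse\<close> returns \<open>Some\<close>.\<close>

lemma zeta_mat_inverse:
  assumes "finite_posdef_space X"
  obtains B where "mat_inverse (zeta_mat X) = Some B" "B \<in> carrier_mat (card (mspace X)) (card (mspace X))"
    "zeta_mat X * B = 1\<^sub>m (card (mspace X))" "B * zeta_mat X = 1\<^sub>m (card (mspace X))"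
proof -
  let ?n = "card (mspace X)" and ?A = "zeta_mat X"
  note A = zeta_mat_carrier[of X]
  have pos: "v \<bullet> (?A *\<^sub>v v) > 0" if "v \<in> carrier_vec ?n" "v \<noteq> 0\<^sub>v ?n" for v
    using assms A that by (auto simp: finite_posdef_space_def positive_definite_mat_def)
  have "det ?A \<noteq> 0"
  proof
    assume "det ?A = 0"
    then obtain v where v: "v \<in> carrier_vec ?n" "v \<noteq> 0\<^sub>v ?n" "?A *\<^sub>v v = 0\<^sub>v ?n"
      using det_0_iff_vec_prod_zero[OF A] by blast
    then show False using pos[OF v(1,2)] by simp
  qed
  then have "?A \<in> Units (ring_mat TYPE(real) ?n ())" by (rule det_non_zero_imp_unit[OF A])
  then obtain B where "mat_inverse ?A = Some B"
    using mat_inverse(1)[OF A, of "()"] by (cases "mat_inverse ?A") auto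
  with mat_inverse(2)[OF A this] that show ?thesis by blast
qed

lemma zeta_solvable:
  assumes "finite_posdef_space X"
  shows "\<exists>u. \<forall>x\<in>mspace X. (\<Sum>y\<in>mspace X. exp (- mdist X x y) * u y) = g x"
proof -
  let ?n = "card (mspace X)" and ?A = "zeta_mat X"
  obtain B where B: "B \<in> carrier_mat ?n ?n" "?A * B = 1\<^sub>m ?n"
    using zeta_mat_inverse[OF assms] by blast
  have fin: "finite (mspace X)" using assms by (simp add: finite_posdef_space_def)
  define gv where "gv = vec ?n (\<lambda>j. g (points X ! j))"
  have gv: "gv \<in> carrier_vec ?n" by (simp add: gv_def)
  define v where "v = B *\<^sub>v gv"
  have v: "v \<in> carrier_vec ?n" unfolding v_def using B(1) gv by (rule mult_mat_vec_carrier)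
  have Av: "?A *\<^sub>v v = gv"
    unfolding v_def using assoc_mult_mat_vec[OF zeta_mat_carrier B(1) gv] B gv by simp
  obtain u where u: "\<And>j. j < ?n \<Longrightarrow> v $ j = u (points X ! j)"
    using points_coordinates[OF fin, of "\<lambda>j. v $ j"] by blast
  have "(\<Sum>y\<in>mspace X. exp (- mdist X x y) * u y) = g x" if x: "x \<in> mspace X" for x
  proof -
    obtain i where i: "i < ?n" "x = points X ! i" by (rule points_index[OF fin x])
    then show ?thesis using zeta_mat_mult_vec[OF fin i(1) v u] Av by (simp add: gv_def)
  qed
  then show ?thesis by blast
qed

text \<open>With \<open>B\<close> the inverse, the equations say that \<open>w\<close> is
  \<open>B\<close> applied to the all-ones vector, so the sum of \<open>w\<close> is the sum of all
  entries of \<open>B\<close>. Explicit magnitudes below are computed in this way.\<close>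

lemma magnitude_eq_sum_weighting:
  assumes "finite_posdef_space X"
    and w: "\<And>x. x \<in> mspace X \<Longrightarrow> (\<Sum>y\<in>mspace X. exp (- mdist X x y) * w y) = 1"
  shows "magnitude X = sum w (mspace X)"
proof -
  let ?n = "card (mspace X)" and ?A = "zeta_mat X"
  obtain B where B: "mat_inverse ?A = Some B" "B \<in> carrier_mat ?n ?n" "B * ?A = 1\<^sub>m ?n"
    using zeta_mat_inverse[OF assms(1)] by blast
  have fin: "finite (mspace X)" using assms by (simp add: finite_posdef_space_def)
  define v where "v = vec ?n (\<lambda>j. w (points X ! j))"
  define e where "e = vec ?n (\<lambda>j. 1 :: real)"
  have v: "v \<in> carrier_vec ?n" "\<And>j. j < ?n \<Longrightarrow> v $ j = w (points X ! j)" by (auto simp: v_def)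
  have "(?A *\<^sub>v v) $ i = 1" if "i < ?n" for i
  proof -
    have "points X ! i \<in> mspace X" by (rule points_nth_mem[OF fin that])
    then show ?thesis using zeta_mat_mult_vec[OF fin that v] w by simp
  qed
  then have "?A *\<^sub>v v = e" using zeta_mat_carrier[of X] by (intro eq_vecI) (simp_all add: e_def)
  then have "v = B *\<^sub>v e"
    using assoc_mult_mat_vec[OF B(2) zeta_mat_carrier v(1)] B v by simp
  then have *: "v $ i = (\<Sum>j\<in>{0..<?n}. B $$ (i, j))" if "i < ?n" for i
    using that B by (simp add: e_def scalar_prod_def)
  have "magnitude X = (\<Sum>ij\<in>{0..<?n} \<times> {0..<?n}. B $$ ij)"
    using B by (simp add: magnitude_def sum_mat_def)
  also have "\<dots> = (\<Sum>i\<in>{0..<?n}. \<Sum>j\<in>{0..<?n}. B $$ (i, j))"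
    by (simp add: sum.cartesian_product)
  also have "\<dots> = (\<Sum>i\<in>{0..<?n}. w (points X ! i))"
    using * v(2) by (intro sum.cong) force+
  also have "\<dots> = sum w (mspace X)" by (rule sum_points[OF fin])
  finally show ?thesis .
qed

lemma magnitude_weighting:
  assumes "finite_posdef_space X"
  shows "\<exists>w. (\<forall>x\<in>mspace X. (\<Sum>y\<in>mspace X. exp (- mdist X x y) * w y) = 1) \<and>
    sum w (mspace X) = magnitude X \<and> zeta_bilin (mspace X) (mdist X) w w = magnitude X"
proof -
  obtain w where w: "\<And>x. x \<in> mspace X \<Longrightarrow> (\<Sum>y\<in>mspace X. exp (- mdist X x y) * w y) = 1"
    using zeta_solvable[OF assms, of "\<lambda>_. 1"] by blast
  have "magnitude X = sum w (mspace X)" by (rule magnitude_eq_sum_weighting[OF assms w])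
  moreover have "zeta_bilin (mspace X) (mdist X) w w = sum w (mspace X)"
    using zeta_bilin_left_eq[OF w] by simp
  ultimately show ?thesis using w by auto
qed

text \<open>Cauchy-Schwarz against a solution of the linear system. It serves the magnitude with
  \<open>g\<close> constant, and coercivity with \<open>g\<close> the indicator of a point.\<close>

lemma zeta_bilin_functional_bound:
  assumes "finite_posdef_space X"
    and g: "\<And>x. x \<in> mspace X \<Longrightarrow> (\<Sum>y\<in>mspace X. exp (- mdist X x y) * u y) = g x"
  shows "(\<Sum>x\<in>mspace X. v x * g x)\<^sup>2
    \<le> zeta_bilin (mspace X) (mdist X) u u * zeta_bilin (mspace X) (mdist X) v v"
proof -
  have "zeta_bilin (mspace X) (mdist X) v u = (\<Sum>x\<in>mspace X. v x * g x)"
    by (rule zeta_bilin_left_eq[OF g])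
  moreover have "(zeta_bilin (mspace X) (mdist X) v u)\<^sup>2
    \<le> zeta_bilin (mspace X) (mdist X) v v * zeta_bilin (mspace X) (mdist X) u u"
    using assms(1) by (intro zeta_bilin_Cauchy_Schwarz) (auto simp: finite_posdef_space_iff mdist_commute)
  ultimately show ?thesis by (simp add: mult.commute)
qed

lemma sum_square_le_magnitude:
  assumes "finite_posdef_space X"
  shows "(sum v (mspace X))\<^sup>2 \<le> magnitude X * zeta_bilin (mspace X) (mdist X) v v"
proof -
  obtain w where w: "\<And>x. x \<in> mspace X \<Longrightarrow> (\<Sum>y\<in>mspace X. exp (- mdist X x y) * w y) = 1"
    "sum w (mspace X) = magnitude X" "zeta_bilin (mspace X) (mdist X) w w = magnitude X"
    using magnitude_weighting[OF assms] by auto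
  show ?thesis using zeta_bilin_functional_bound[OF assms w(1), of v] w(3) by simp
qed

lemma magnitude_nonneg:
  assumes "finite_posdef_space X"
  shows "0 \<le> magnitude X"
proof -
  obtain w where "zeta_bilin (mspace X) (mdist X) w w = magnitude X"
    using magnitude_weighting[OF assms] by auto
  then show ?thesis
    using zeta_pos_nonneg[of "mspace X" "mdist X" w] assms by (simp add: finite_posdef_space_iff)
qed

text \<open>At the weighting the hypothesis reads \<open>c |X|^2 \<le> m |X|\<close>, and one factor
  cancels; \<open>0 \<le> m\<close> settles magnitude 0. The upper bounds on magnitudes of
  approximating spaces pass through this lemma.\<close>

lemma magnitude_le_if_form_le:
  assumes "finite_posdef_space X"
    and "\<And>v. c * (sum v (mspace X))\<^sup>2 \<le> m * zeta_bilin (mspace X) (mdist X) v v"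
    and "0 \<le> m"
  shows "c * magnitude X \<le> m"
proof -
  obtain w where w: "\<And>x. x \<in> mspace X \<Longrightarrow> (\<Sum>y\<in>mspace X. exp (- mdist X x y) * w y) = 1"
    "sum w (mspace X) = magnitude X" "zeta_bilin (mspace X) (mdist X) w w = magnitude X"
    using magnitude_weighting[OF assms(1)] by auto
  have *: "c * (magnitude X)\<^sup>2 \<le> m * magnitude X" using assms(2)[of w] w(2,3) by simp
  have "0 \<le> magnitude X" by (rule magnitude_nonneg[OF assms(1)])
  then consider "magnitude X = 0" | "magnitude X > 0" by linarith
  then show ?thesis
    using * assms(3) by cases (auto simp: power2_eq_square)
qed

lemma magnitude_pos:
  assumes "finite_posdef_space X" "mspace X \<noteq> {}"
  shows "0 < magnitude X"
proof -
  obtain w where w: "\<And>x. x \<in> mspace X \<Longrightarrow> (\<Sum>y\<in>mspace X. exp (- mdist X x y) * w y) = 1"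
    "sum w (mspace X) = magnitude X" "zeta_bilin (mspace X) (mdist X) w w = magnitude X"
    using magnitude_weighting[OF assms(1)] by auto
  obtain x where "x \<in> mspace X" using assms by blast
  then have "\<exists>y\<in>mspace X. w y \<noteq> 0" using w(1)[of x] by (intro ccontr[of "Bex _ _"]) simp
  then show ?thesis using assms(1) w(3) by (auto simp: finite_posdef_space_iff zeta_pos_def)
qed

text \<open>The value \<open>v z\<close> is the pairing of \<open>v\<close> with the solution
  \<open>U z\<close> for the indicator of \<open>z\<close>, hence
  \<open>(v z)^2 \<le> Q(U z) Q(v)\<close>. Summing square roots over \<open>z\<close> bounds the
  l_1 norm, in which perturbation errors are measured later.\<close>

lemma zeta_bilin_coercive:
  assumes "finite_posdef_space X"
  shows "\<exists>C>0. \<forall>v. (\<Sum>x\<in>mspace X. \<bar>v x\<bar>)\<^sup>2 \<le> C * zeta_bilin (mspace X) (mdist X) v v"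
proof -
  let ?S = "mspace X" and ?Q = "\<lambda>v. zeta_bilin (mspace X) (mdist X) v v"
  have fin: "finite ?S" and pos: "zeta_pos ?S (mdist X)" using assms by (auto simp: finite_posdef_space_iff)
  have "\<forall>z. \<exists>u. \<forall>x\<in>?S. (\<Sum>y\<in>?S. exp (- mdist X x y) * u y) = of_bool (x = z)"
    by (intro allI zeta_solvable[OF assms])
  then obtain U where U: "\<And>z x. x \<in> ?S \<Longrightarrow> (\<Sum>y\<in>?S. exp (- mdist X x y) * U z y) = of_bool (x = z)"
    using choice[of "\<lambda>z u. \<forall>x\<in>?S. (\<Sum>y\<in>?S. exp (- mdist X x y) * u y) = of_bool (x = z)"] by blast
  have pt: "(v z)\<^sup>2 \<le> ?Q (U z) * ?Q v" if "z \<in> ?S" for v z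
  proof -
    have "(\<Sum>x\<in>?S. v x * of_bool (x = z)) = v z" using fin that by simp
    then show ?thesis using zeta_bilin_functional_bound[OF assms U[of _ z], where v = v] by simp
  qed
  define c where "c = (\<Sum>z\<in>?S. sqrt (?Q (U z)))"
  have "c \<ge> 0" unfolding c_def using zeta_pos_nonneg[OF pos] by (simp add: sum_nonneg)
  \<comment> \<open>The added 1 makes the constant positive even for the empty space, where
    \<open>c = 0\<close>.\<close>
  have "(\<Sum>x\<in>?S. \<bar>v x\<bar>)\<^sup>2 \<le> (c\<^sup>2 + 1) * ?Q v" for v
  proof -
    have Q0: "0 \<le> ?Q v" by (rule zeta_pos_nonneg[OF pos])
    have "\<bar>v z\<bar> \<le> sqrt (?Q (U z)) * sqrt (?Q v)" if "z \<in> ?S" for z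
      using real_sqrt_le_mono[OF pt[OF that, of v]] by (simp add: real_sqrt_mult)
    then have "(\<Sum>x\<in>?S. \<bar>v x\<bar>) \<le> c * sqrt (?Q v)"
      unfolding c_def sum_distrib_right by (intro sum_mono)
    then have "(\<Sum>x\<in>?S. \<bar>v x\<bar>)\<^sup>2 \<le> (c * sqrt (?Q v))\<^sup>2"
      by (intro power_mono) (auto intro: sum_nonneg)
    also have "\<dots> = c\<^sup>2 * ?Q v" using Q0 by (simp add: power_mult_distrib)
    also have "\<dots> \<le> (c\<^sup>2 + 1) * ?Q v" using Q0 by (intro mult_right_mono) auto
    finally show ?thesis .
  qed
  moreover have "c\<^sup>2 + 1 > 0" by (simp add: add_nonneg_pos)
  ultimately show ?thesis by blast
qed

section \<open>Gromov--Hausdorff approximation and lower semicontinuity\<close>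

lemma mdist_self: "x \<in> mspace m \<Longrightarrow> mdist m x x = 0"
  by simp

text \<open>Here \<open>p\<close> projects the approximating space \<open>Y\<close> to the limit
  \<open>X\<close>. A single map replaces a correspondence: when \<open>e\<close> is small compared
  with the separation of \<open>X\<close>, the fibres of \<open>p\<close> are the clusters of
  \<open>Y\<close>.\<close>

definition distortion_le :: "'b metric \<Rightarrow> 'a metric \<Rightarrow> ('b \<Rightarrow> 'a) \<Rightarrow> real \<Rightarrow> bool" where
  "distortion_le Y X p e \<longleftrightarrow>
    (\<forall>y\<in>mspace Y. \<forall>y'\<in>mspace Y. \<bar>mdist X (p y) (p y') - mdist Y y y'\<bar> \<le> e)"

text \<open>In an ambient space realising a Hausdorff distance below \<open>e\<close>, the maps
  \<open>p\<close> and \<open>s\<close> choose partners at distance less than \<open>e\<close>. Each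
  estimate moves two points, which costs \<open>2 * e\<close>.\<close>

lemma GH_dist_less_imp_correspondence:
  fixes X :: "'a metric" and Y :: "'b metric"
  assumes "GH_dist Y X < ennreal e"
  shows "\<exists>p s. (\<forall>y\<in>mspace Y. p y \<in> mspace X) \<and> (\<forall>x\<in>mspace X. s x \<in> mspace Y) \<and>
    distortion_le Y X p (2 * e) \<and> (\<forall>x\<in>mspace X. mdist X (p (s x)) x < 2 * e)"
proof -
  obtain Z :: "('b + 'a) metric" and f g where
    Z: "Hausdorff_dist Z (f ` mspace Y) (g ` mspace X) < ennreal e"
      and f: "isometric_embedding Y Z f" and g: "isometric_embedding X Z g"
  proof -
    obtain h where "h \<in> {Hausdorff_dist Z (f ` mspace Y) (g ` mspace X) | (Z :: ('b + 'a) metric) f g.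
        isometric_embedding Y Z f \<and> isometric_embedding X Z g}" and h: "h < ennreal e"
      using assms unfolding GH_dist_def Inf_less_iff ..
    then obtain Z :: "('b + 'a) metric" and f g where "h = Hausdorff_dist Z (f ` mspace Y) (g ` mspace X)"
        "isometric_embedding Y Z f" "isometric_embedding X Z g"
      unfolding mem_Collect_eq by (elim exE conjE)
    with h show thesis by (intro that[of Z f g]) simp_all
  qed
  note fd = f[unfolded isometric_embedding_def] and gd = g[unfolded isometric_embedding_def]
  have less: "a < e" if "ennreal a < ennreal e" for a
    using that ennreal_leI[of e a] by (meson linorder_not_less)
  have "\<exists>x\<in>mspace X. mdist Z (f y) (g x) < e" if "y \<in> mspace Y" for y
  proof -
    have "(INF b\<in>g ` mspace X. ennreal (mdist Z (f y) b))
        \<le> (SUP a\<in>f ` mspace Y. INF b\<in>g ` mspace X. ennreal (mdist Z a b))"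
      using that by (intro SUP_upper) auto
    also have "\<dots> < ennreal e" using Z by (simp add: Hausdorff_dist_def)
    finally show ?thesis unfolding INF_less_iff using less by blast
  qed
  then obtain p where p: "\<And>y. y \<in> mspace Y \<Longrightarrow> p y \<in> mspace X"
    "\<And>y. y \<in> mspace Y \<Longrightarrow> mdist Z (f y) (g (p y)) < e" by metis
  have "\<exists>y\<in>mspace Y. mdist Z (f y) (g x) < e" if "x \<in> mspace X" for x
  proof -
    have "(INF a\<in>f ` mspace Y. ennreal (mdist Z a (g x)))
        \<le> (SUP b\<in>g ` mspace X. INF a\<in>f ` mspace Y. ennreal (mdist Z a b))"
      using that by (intro SUP_upper) auto
    also have "\<dots> < ennreal e" using Z by (simp add: Hausdorff_dist_def)
    finally show ?thesis unfolding INF_less_iff using less by blast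
  qed
  then obtain s where s: "\<And>x. x \<in> mspace X \<Longrightarrow> s x \<in> mspace Y"
    "\<And>x. x \<in> mspace X \<Longrightarrow> mdist Z (f (s x)) (g x) < e" by metis
  have fZ: "f y \<in> mspace Z" if "y \<in> mspace Y" for y using fd that by auto
  have gZ: "g x \<in> mspace Z" if "x \<in> mspace X" for x using gd that by auto
  have "distortion_le Y X p (2 * e)"
    unfolding distortion_le_def
  proof (intro ballI)
    fix y y' assume y: "y \<in> mspace Y" and y': "y' \<in> mspace Y"
    have "mdist X (p y) (p y') = mdist Z (g (p y)) (g (p y'))" "mdist Y y y' = mdist Z (f y) (f y')"
      using fd gd p y y' by auto
    moreover have "mdist Z (f y) (f y') \<le> mdist Z (f y) (g (p y)) + mdist Z (g (p y)) (f y')"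
      "mdist Z (g (p y)) (f y') \<le> mdist Z (g (p y)) (g (p y')) + mdist Z (g (p y')) (f y')"
      "mdist Z (g (p y)) (g (p y')) \<le> mdist Z (g (p y)) (f y) + mdist Z (f y) (g (p y'))"
      "mdist Z (f y) (g (p y')) \<le> mdist Z (f y) (f y') + mdist Z (f y') (g (p y'))"
      using y y' p fZ gZ by (auto intro!: mdist_triangle)
    ultimately show "\<bar>mdist X (p y) (p y') - mdist Y y y'\<bar> \<le> 2 * e"
      using p(2)[OF y] p(2)[OF y'] by (simp add: mdist_commute)
  qed
  moreover have "mdist X (p (s x)) x < 2 * e" if x: "x \<in> mspace X" for x
  proof -
    have "mdist X (p (s x)) x = mdist Z (g (p (s x))) (g x)" using gd p s x by auto
    also have "\<dots> \<le> mdist Z (g (p (s x))) (f (s x)) + mdist Z (f (s x)) (g x)"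
      using x p s fZ gZ by (auto intro!: mdist_triangle)
    also have "\<dots> < 2 * e" using p(2)[OF s(1)[OF x]] s(2)[OF x] by (simp add: mdist_commute)
    finally show ?thesis .
  qed
  ultimately show ?thesis using p s by blast
qed

text \<open>Separation turns \<open>mdist X (p (s x)) x < 2 * e\<close> into
  \<open>p (s x) = x\<close>, so \<open>p\<close> is onto.\<close>

lemma GH_dist_less_imp_surjection:
  assumes "GH_dist Y X < ennreal e"
    and sep: "\<And>x x'. x \<in> mspace X \<Longrightarrow> x' \<in> mspace X \<Longrightarrow> x \<noteq> x' \<Longrightarrow> 2 * e \<le> mdist X x x'"
  shows "\<exists>p. p ` mspace Y = mspace X \<and> distortion_le Y X p (2 * e)"
proof -
  obtain p s where p: "\<forall>y\<in>mspace Y. p y \<in> mspace X" and s: "\<forall>x\<in>mspace X. s x \<in> mspace Y"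
    and d: "distortion_le Y X p (2 * e)" and ps: "\<forall>x\<in>mspace X. mdist X (p (s x)) x < 2 * e"
    using GH_dist_less_imp_correspondence[OF assms(1)] by blast
  have "p (s x) = x" if "x \<in> mspace X" for x
    using sep[of "p (s x)" x] ps p s that by force
  then have "p ` mspace Y = mspace X" using p s by force
  with d show ?thesis by blast
qed

lemma separated_finite_mspace:
  assumes "finite (mspace X)"
  shows "\<exists>D>0. \<forall>x\<in>mspace X. \<forall>x'\<in>mspace X. x \<noteq> x' \<longrightarrow> D \<le> mdist X x x'"
proof -
  \<comment> \<open>The inserted 1 provides a minimum for spaces with at most one point.\<close>
  define A where "A = insert 1 ((\<lambda>(x, x'). mdist X x x') ` {(x, x'). x \<in> mspace X \<and> x' \<in> mspace X \<and> x \<noteq> x'})"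
  have "finite {(x, x'). x \<in> mspace X \<and> x' \<in> mspace X \<and> x \<noteq> x'}"
    by (rule finite_subset[of _ "mspace X \<times> mspace X"]) (use assms in auto)
  then have fin: "finite A" by (simp add: A_def)
  have "0 < mdist X x x'" if "x \<in> mspace X" "x' \<in> mspace X" "x \<noteq> x'" for x x'
    using that by (metis mdist_nonneg mdist_zero order_le_less)
  then have "\<And>a. a \<in> A \<Longrightarrow> 0 < a" by (auto simp: A_def)
  then have "0 < Min A" using fin by (subst Min_gr_iff) (auto simp: A_def)
  moreover have "Min A \<le> mdist X x x'" if "x \<in> mspace X" "x' \<in> mspace X" "x \<noteq> x'" for x x'
    by (rule Min_le[OF fin]) (use that in \<open>auto simp: A_def\<close>)
  ultimately show ?thesis by blast
qed

text \<open>For arguments at least \<open>m\<close> the slope of \<open>exp (- t)\<close> is at most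
  \<open>exp (- m)\<close>. The bound with \<open>m > 0\<close> will weaken the interaction between
  distant fibres.\<close>

lemma exp_minus_lipschitz:
  fixes a b m :: real
  assumes "m \<le> a" "m \<le> b"
  shows "\<bar>exp (- a) - exp (- b)\<bar> \<le> exp (- m) * \<bar>a - b\<bar>"
proof -
  have *: "exp (- a) - exp (- b) \<le> exp (- m) * (b - a)" if "m \<le> a" "a \<le> b" for a b
  proof -
    have "exp (- a) - exp (- b) = exp (- a) * (1 - exp (a - b))" by (simp add: algebra_simps flip: exp_add)
    also have "\<dots> \<le> exp (- a) * (b - a)" using exp_ge_add_one_self[of "a - b"] by (intro mult_left_mono) (linarith, simp)
    also have "\<dots> \<le> exp (- m) * (b - a)" using that by (intro mult_right_mono) auto
    finally show ?thesis .
  qed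
  show ?thesis using *[of a b] *[of b a] assms by (cases "a \<le> b") (auto simp: abs_if)
qed

lemma zeta_bilin_perturb:
  assumes "\<And>x y. x \<in> S \<Longrightarrow> y \<in> S \<Longrightarrow> 0 \<le> d x y" "\<And>x y. x \<in> S \<Longrightarrow> y \<in> S \<Longrightarrow> 0 \<le> d' x y"
    and "\<And>x y. x \<in> S \<Longrightarrow> y \<in> S \<Longrightarrow> \<bar>d x y - d' x y\<bar> \<le> e"
  shows "\<bar>zeta_bilin S d u u - zeta_bilin S d' u u\<bar> \<le> e * (\<Sum>x\<in>S. \<bar>u x\<bar>)\<^sup>2"
proof -
  have pt: "\<bar>(exp (- d x y) - exp (- d' x y)) * u x * u y\<bar> \<le> e * (\<bar>u x\<bar> * \<bar>u y\<bar>)" if "x \<in> S" "y \<in> S" for x y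
  proof -
    have "\<bar>exp (- d x y) - exp (- d' x y)\<bar> \<le> e"
      using exp_minus_lipschitz[of 0 "d x y" "d' x y"] assms(1,2,3)[OF that] by simp
    then have "\<bar>exp (- d x y) - exp (- d' x y)\<bar> * (\<bar>u x\<bar> * \<bar>u y\<bar>) \<le> e * (\<bar>u x\<bar> * \<bar>u y\<bar>)"
      by (rule mult_right_mono) simp
    then show ?thesis by (simp add: abs_mult mult_ac)
  qed
  have "zeta_bilin S d u u - zeta_bilin S d' u u
      = (\<Sum>x\<in>S. \<Sum>y\<in>S. (exp (- d x y) - exp (- d' x y)) * u x * u y)"
    by (simp add: zeta_bilin_def sum_subtractf algebra_simps)
  also have "\<bar>\<dots>\<bar> \<le> (\<Sum>x\<in>S. \<Sum>y\<in>S. e * (\<bar>u x\<bar> * \<bar>u y\<bar>))"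
    by (intro order.trans[OF sum_abs] sum_mono pt)
  also have "\<dots> = e * (\<Sum>x\<in>S. \<bar>u x\<bar>)\<^sup>2"
    unfolding power2_eq_square sum_product by (simp add: sum_distrib_left)
  finally show ?thesis .
qed

text \<open>A change of basis tested against \<open>F\<close>: \<open>v\<close> becomes the fibre
  masses placed at the base points \<open>s x\<close>, plus multiples of the differences between an
  extra point and its base point.\<close>

lemma sum_over_section:
  fixes v F :: "'b \<Rightarrow> real"
  assumes "finite T" "finite S" "p ` T \<subseteq> S" "s ` S \<subseteq> T" "\<And>x. x \<in> S \<Longrightarrow> p (s x) = x"
  shows "(\<Sum>y\<in>T. v y * F y) = (\<Sum>x\<in>S. (\<Sum>y | y \<in> T \<and> p y = x. v y) * F (s x))
    + (\<Sum>e\<in>T - s ` S. v e * (F e - F (s (p e))))"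
proof -
  have "(\<Sum>x\<in>S. (\<Sum>y | y \<in> T \<and> p y = x. v y) * F (s x)) = (\<Sum>x\<in>S. \<Sum>y | y \<in> T \<and> p y = x. v y * F (s (p y)))"
    by (simp add: sum_distrib_right)
  also have "\<dots> = (\<Sum>y\<in>T. v y * F (s (p y)))"
    by (rule sum.group) (use assms in auto)
  finally have 1: "(\<Sum>x\<in>S. (\<Sum>y | y \<in> T \<and> p y = x. v y) * F (s x)) = (\<Sum>y\<in>T. v y * F (s (p y)))" .
  \<comment> \<open>The terms added on the right vanish, since \<open>s (p y) = y\<close> at a base
    point \<open>y\<close>.\<close>
  have "(\<Sum>e\<in>T - s ` S. v e * (F e - F (s (p e)))) = (\<Sum>e\<in>T. v e * (F e - F (s (p e))))"
    by (rule sum.mono_neutral_left) (use assms in auto)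
  with 1 show ?thesis by (simp add: sum_subtractf algebra_simps)
qed

text \<open>The weighting of \<open>X\<close>, transplanted to one point of each fibre, keeps its
  sum, and its form changes by at most \<open>C * e\<close>. The constant depends on
  \<open>X\<close> alone.\<close>

lemma magnitude_lower_near:
  assumes X: "finite_posdef_space X"
  shows "\<exists>C. \<forall>(Y :: 'b metric) p e. finite_posdef_space Y \<and> p ` mspace Y = mspace X \<and> distortion_le Y X p e
      \<longrightarrow> (magnitude X)\<^sup>2 \<le> magnitude Y * (magnitude X + C * e)"
proof -
  obtain w where w: "sum w (mspace X) = magnitude X" "zeta_bilin (mspace X) (mdist X) w w = magnitude X"
    using magnitude_weighting[OF X] by auto
  define C where "C = (\<Sum>x\<in>mspace X. \<bar>w x\<bar>)\<^sup>2"
  have "(magnitude X)\<^sup>2 \<le> magnitude Y * (magnitude X + C * e)"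
    if Y: "finite_posdef_space Y" and p: "p ` mspace Y = mspace X" and d: "distortion_le Y X p e"
    for Y :: "'b metric" and p e
  proof -
    let ?S = "mspace X" and ?T = "mspace Y"
    have fin: "finite ?S" "finite ?T" using X Y by (auto simp: finite_posdef_space_def)
    define s where "s = inv_into ?T p"
    have s: "s ` ?S \<subseteq> ?T" "\<And>x. x \<in> ?S \<Longrightarrow> p (s x) = x"
      using p by (auto simp: s_def inv_into_into f_inv_into_f)
    have inj: "inj_on s ?S" using s(2) by (rule inj_on_inverseI)
    define v where "v y = (if y \<in> s ` ?S then w (p y) else 0)" for y
    have sum_v: "(\<Sum>y\<in>?T. F y * v y) = (\<Sum>x\<in>?S. F (s x) * w x)" for F
    proof -
      have "(\<Sum>y\<in>?T. F y * v y) = (\<Sum>y\<in>s ` ?S. F y * w (p y))"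
        unfolding v_def by (rule sum.mono_neutral_cong_right) (use fin s in auto)
      also have "\<dots> = (\<Sum>x\<in>?S. F (s x) * w x)" using inj s(2) by (simp add: sum.reindex)
      finally show ?thesis .
    qed
    have "zeta_bilin ?T (mdist Y) v v = (\<Sum>y\<in>?T. (\<Sum>z\<in>?T. exp (- mdist Y y z) * v z) * v y)"
      by (simp add: zeta_bilin_def sum_distrib_left sum_distrib_right mult_ac)
    also have "\<dots> = (\<Sum>x\<in>?S. (\<Sum>x'\<in>?S. exp (- mdist Y (s x) (s x')) * w x') * w x)"
      unfolding sum_v ..
    also have "\<dots> = zeta_bilin ?S (\<lambda>x x'. mdist Y (s x) (s x')) w w"
      by (simp add: zeta_bilin_def sum_distrib_left sum_distrib_right mult_ac)
    also have "\<bar>\<dots> - zeta_bilin ?S (mdist X) w w\<bar> \<le> e * C"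
      unfolding C_def
    proof (rule zeta_bilin_perturb)
      fix x x' assume "x \<in> ?S" "x' \<in> ?S"
      then have "s x \<in> ?T" "s x' \<in> ?T" "p (s x) = x" "p (s x') = x'" using s by auto
      then show "\<bar>mdist Y (s x) (s x') - mdist X x x'\<bar> \<le> e"
        using d unfolding distortion_le_def by fastforce
    qed auto
    finally have "zeta_bilin ?T (mdist Y) v v \<le> magnitude X + C * e" using w by (simp add: mult.commute)
    moreover have "sum v ?T = magnitude X" using sum_v[of "\<lambda>_. 1"] w by simp
    ultimately show ?thesis
      using order_trans[OF sum_square_le_magnitude[OF Y, of v] mult_left_mono[OF _ magnitude_nonneg[OF Y]]]
      by simp
  qed
  then show ?thesis by (intro exI[of _ C] allI impI, elim conjE) blast
qed

section \<open>At most two additional points\<close>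

text \<open>In a fibre with three points the base point is taken opposite to a longest side.\<close>

lemma fibre_base_point:
  assumes "F \<noteq> {}" "finite F" "card F \<le> 3"
  shows "\<exists>b\<in>F. \<forall>e\<in>F - {b}. \<forall>f\<in>F - {b}. e \<noteq> f \<longrightarrow> mdist Y e b \<le> mdist Y e f"
proof (cases "card F = 3")
  case True
  then obtain x y z where F: "F = {x, y, z}" "x \<noteq> y" "y \<noteq> z" "x \<noteq> z"
    by (auto simp: card_3_iff)
  note c = mdist_commute[of Y x y] mdist_commute[of Y x z] mdist_commute[of Y y z]
  consider "mdist Y y z \<le> mdist Y x y \<and> mdist Y x z \<le> mdist Y x y"
    | "mdist Y y x \<le> mdist Y z y \<and> mdist Y x z \<le> mdist Y z y"
    | "mdist Y y x \<le> mdist Y x z \<and> mdist Y y z \<le> mdist Y x z"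
    using c by linarith
  then show ?thesis
  proof cases
    case 1
    then show ?thesis using F c by (intro bexI[of _ z]) auto
  next
    case 2
    then show ?thesis using F c by (intro bexI[of _ x]) auto
  next
    case 3
    then show ?thesis using F c by (intro bexI[of _ y]) auto
  qed
next
  case False
  \<comment> \<open>The fibre has at most two points, so at most one remains besides
    \<open>b\<close> and the condition is vacuous.\<close>
  obtain b where b: "b \<in> F" using assms by blast
  have "card (F - {b}) \<le> Suc 0" using b assms False by (simp add: card_Diff_singleton)
  then have "\<forall>e\<in>F - {b}. \<forall>f\<in>F - {b}. e = f"
    using card_le_Suc0_iff_eq[of "F - {b}"] assms by simp
  with b show ?thesis by blast
qed

text \<open>The other fibres are nonempty and use up at least \<open>card S - 1\<close> points. With
  two points to spare, a fibre has at most three.\<close>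

lemma card_fibre_le:
  assumes "finite T" "p ` T = S" "x \<in> S"
  shows "card {y \<in> T. p y = x} + card S \<le> card T + 1"
proof -
  have finS: "finite S" using assms by blast
  have "card T = (\<Sum>z\<in>S. card {y \<in> T. p y = z})"
    using sum.group[of T S p "\<lambda>_. 1 :: nat"] assms finS by simp
  also have "\<dots> = card {y \<in> T. p y = x} + (\<Sum>z\<in>S - {x}. card {y \<in> T. p y = z})"
    using finS assms(3) by (rule sum.remove)
  finally have eq: "card T = card {y \<in> T. p y = x} + (\<Sum>z\<in>S - {x}. card {y \<in> T. p y = z})" .
  have "(\<Sum>z\<in>S - {x}. 1) \<le> (\<Sum>z\<in>S - {x}. card {y \<in> T. p y = z})"
  proof (rule sum_mono)
    fix z assume "z \<in> S - {x}"
    then have "{y \<in> T. p y = z} \<noteq> {}" using assms by blast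
    then show "1 \<le> card {y \<in> T. p y = z}" using assms(1) by (simp add: Suc_le_eq card_gt_0_iff)
  qed
  moreover have "(\<Sum>z\<in>S - {x}. 1) = card S - 1" using finS assms(3) by simp
  ultimately show ?thesis using eq by linarith
qed

text \<open>The chosen base points form a section. Afterwards two extra points of one fibre are at
  least as far apart as each is from their base point.\<close>

lemma section_with_base_points:
  assumes "finite (mspace Y)" "p ` mspace Y = S" "card (mspace Y) \<le> card S + 2"
  shows "\<exists>s. s ` S \<subseteq> mspace Y \<and> (\<forall>x\<in>S. p (s x) = x) \<and> card (mspace Y - s ` S) \<le> 2 \<and>
    (\<forall>e\<in>mspace Y - s ` S. \<forall>f\<in>mspace Y - s ` S. e \<noteq> f \<and> p e = p f \<longrightarrow>
        mdist Y e (s (p e)) \<le> mdist Y e f)"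
proof -
  define F where "F x = {y \<in> mspace Y. p y = x}" for x
  have "\<exists>b\<in>F x. \<forall>e\<in>F x - {b}. \<forall>f\<in>F x - {b}. e \<noteq> f \<longrightarrow> mdist Y e b \<le> mdist Y e f" if "x \<in> S" for x
  proof (rule fibre_base_point)
    show "F x \<noteq> {}" using that assms by (auto simp: F_def)
    show "finite (F x)" using assms by (simp add: F_def)
    show "card (F x) \<le> 3" using card_fibre_le[OF assms(1,2) that] assms(3) by (simp add: F_def)
  qed
  then obtain s where s: "\<And>x. x \<in> S \<Longrightarrow> s x \<in> F x"
    "\<And>x e f. x \<in> S \<Longrightarrow> e \<in> F x - {s x} \<Longrightarrow> f \<in> F x - {s x} \<Longrightarrow> e \<noteq> f \<Longrightarrow> mdist Y e (s x) \<le> mdist Y e f"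
    by metis
  have sub: "s ` S \<subseteq> mspace Y" and sec: "\<And>x. x \<in> S \<Longrightarrow> p (s x) = x"
    using s(1) by (auto simp: F_def)
  have "inj_on s S" using sec by (rule inj_on_inverseI)
  then have "card (s ` S) = card S" by (rule card_image)
  then have "card (mspace Y - s ` S) \<le> 2"
    using card_Diff_subset[OF finite_subset[OF sub assms(1)] sub] assms(3) by simp
  moreover have "mdist Y e (s (p e)) \<le> mdist Y e f"
    if "e \<in> mspace Y - s ` S" "f \<in> mspace Y - s ` S" "e \<noteq> f" "p e = p f" for e f
  proof -
    have "p e \<in> S" using that assms(2) by blast
    then show ?thesis using s(2)[of "p e" e f] that by (auto simp: F_def)
  qed
  ultimately show ?thesis using sub sec by blast
qed

text \<open>With at most two indices each row has at most one off-diagonal entry, so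
  \<open>r < \<gamma>\<close> suffices for positivity; three indices would cost \<open>2 r\<close>.
  The minimum in the hypothesis lets the cross term be shared between both diagonal terms.\<close>

lemma diagonally_dominant_form:
  fixes G :: "'b \<Rightarrow> 'b \<Rightarrow> real"
  assumes "finite E" "card E \<le> 2"
    and "\<And>e. e \<in> E \<Longrightarrow> 0 \<le> \<delta> e"
    and diag: "\<And>e. e \<in> E \<Longrightarrow> \<gamma> * \<delta> e \<le> G e e"
    and off: "\<And>e f. e \<in> E \<Longrightarrow> f \<in> E \<Longrightarrow> e \<noteq> f \<Longrightarrow> \<bar>G e f\<bar> \<le> r * min (\<delta> e) (\<delta> f)" and "0 \<le> r"
  shows "(\<gamma> - r) * (\<Sum>e\<in>E. \<delta> e * (v e)\<^sup>2) \<le> (\<Sum>e\<in>E. \<Sum>f\<in>E. v e * v f * G e f)"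
proof -
  have d: "\<gamma> * (\<delta> e * (v e)\<^sup>2) \<le> v e * v e * G e e" if "e \<in> E" for e
  proof -
    have "(v e)\<^sup>2 * (\<gamma> * \<delta> e) \<le> (v e)\<^sup>2 * G e e" by (intro mult_left_mono diag that) simp
    then show ?thesis by (simp add: power2_eq_square mult_ac)
  qed
  have o: "\<bar>v e * v f * G e f\<bar> \<le> r * (\<delta> e * (v e)\<^sup>2 + \<delta> f * (v f)\<^sup>2) / 2"
    if ef: "e \<in> E" "f \<in> E" "e \<noteq> f" for e f
  proof -
    let ?m = "min (\<delta> e) (\<delta> f)"
    have "2 * \<bar>v e * v f\<bar> \<le> (v e)\<^sup>2 + (v f)\<^sup>2"
      using sum_squares_bound[of "\<bar>v e\<bar>" "\<bar>v f\<bar>"] by (simp add: abs_mult)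
    then have "?m * (2 * \<bar>v e * v f\<bar>) \<le> ?m * ((v e)\<^sup>2 + (v f)\<^sup>2)"
      using assms(3) ef by (intro mult_left_mono) auto
    also have "\<dots> \<le> \<delta> e * (v e)\<^sup>2 + \<delta> f * (v f)\<^sup>2"
      unfolding distrib_left by (intro add_mono mult_right_mono) auto
    finally have *: "\<bar>v e * v f\<bar> * ?m \<le> (\<delta> e * (v e)\<^sup>2 + \<delta> f * (v f)\<^sup>2) / 2" by (simp add: mult_ac)
    have "\<bar>v e * v f * G e f\<bar> \<le> \<bar>v e * v f\<bar> * (r * ?m)"
      unfolding abs_mult[of "v e * v f"] by (intro mult_left_mono off ef) simp
    also have "\<dots> \<le> r * ((\<delta> e * (v e)\<^sup>2 + \<delta> f * (v f)\<^sup>2) / 2)"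
      using mult_left_mono[OF * \<open>0 \<le> r\<close>] by (simp add: mult_ac)
    finally show ?thesis by simp
  qed
  consider "E = {}" | e where "E = {e}" | e f where "E = {e, f}" "e \<noteq> f"
  proof -
    have "card E = 0 \<or> card E = 1 \<or> card E = 2" using assms(2) by linarith
    then show thesis using that assms(1) by (auto simp: card_1_singleton_iff card_2_iff)
  qed
  then show ?thesis
  proof cases
    case (2 e)
    have "r * (\<delta> e * (v e)\<^sup>2) \<ge> 0" using assms(3)[of e] \<open>0 \<le> r\<close> 2 by simp
    then show ?thesis using d[of e] 2 by (simp add: left_diff_distrib)
  next
    case (3 e f)
    have "(\<gamma> - r) * (\<delta> e * (v e)\<^sup>2 + \<delta> f * (v f)\<^sup>2) = \<gamma> * (\<delta> e * (v e)\<^sup>2) + \<gamma> * (\<delta> f * (v f)\<^sup>2)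
       - r * (\<delta> e * (v e)\<^sup>2 + \<delta> f * (v f)\<^sup>2) / 2 - r * (\<delta> f * (v f)\<^sup>2 + \<delta> e * (v e)\<^sup>2) / 2"
      by (simp add: field_simps)
    also have "\<dots> \<le> v e * v e * G e e + v f * v f * G f f + v e * v f * G e f + v f * v e * G f e"
      using d[of e] d[of f] o[of e f] o[of f e] 3 by (auto simp: abs_le_iff)
    finally show ?thesis using 3 by (simp add: algebra_simps)
  qed simp
qed

text \<open>Compare \<open>exp (- t) (1 + t) \<le> 1\<close> with
  \<open>(1 - t + t^2) (1 + t) = 1 + t^3\<close>.\<close>

lemma one_minus_exp_ge:
  fixes t :: real
  assumes "0 \<le> t"
  shows "t - t\<^sup>2 \<le> 1 - exp (- t)"
proof -
  have "exp (- t) * (1 + t) \<le> 1"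
    using exp_ge_add_one_self[of t] by (simp add: exp_minus field_simps)
  moreover have "(1 - t + t\<^sup>2) * (1 + t) \<ge> 1"
    using assms by (simp add: algebra_simps power2_eq_square)
  ultimately have "exp (- t) * (1 + t) \<le> (1 - t + t\<^sup>2) * (1 + t)" by linarith
  then have "exp (- t) \<le> 1 - t + t\<^sup>2" using assms by (subst (asm) mult_le_cancel_right_pos) auto
  then show ?thesis by simp
qed

text \<open>If \<open>V\<close> collects the fibre masses of \<open>v\<close>, both have the same
  sum, and the form of \<open>Y\<close> at \<open>v\<close> is at least \<open>1 - K * e\<close>
  times the form of \<open>X\<close> at \<open>V\<close>. The constants depend on \<open>X\<close>
  alone.\<close>

lemma magnitude_upper_near:
  assumes X: "finite_posdef_space X"
  shows "\<exists>K. \<exists>e0>0. \<forall>(Y :: 'b metric) p e. finite_posdef_space Y \<and> p ` mspace Y = mspace X \<and>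
      distortion_le Y X p e \<and> card (mspace Y) \<le> card (mspace X) + 2 \<and> 0 \<le> e \<and> e \<le> e0
      \<longrightarrow> (1 - K * e) * magnitude Y \<le> magnitude X"
proof -
  have finS: "finite (mspace X)" using X by (simp add: finite_posdef_space_def)
  obtain D where D: "D > 0" "\<And>x x'. x \<in> mspace X \<Longrightarrow> x' \<in> mspace X \<Longrightarrow> x \<noteq> x' \<Longrightarrow> D \<le> mdist X x x'"
    using separated_finite_mspace[OF finS] by metis
  obtain C where C: "C > 0" "\<And>v. (\<Sum>x\<in>mspace X. \<bar>v x\<bar>)\<^sup>2 \<le> C * zeta_bilin (mspace X) (mdist X) v v"
    using zeta_bilin_coercive[OF X] by metis
  \<comment> \<open>Relative to distances from base points, off-diagonal entries are bounded by 1
    within a fibre and by \<open>2 * exp (- (D / 2))\<close> between fibres. Both are below 2, the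
    limit coefficient on the diagonal.\<close>
  define r where "r = max 1 (2 * exp (- (D / 2)))"
  have r: "1 \<le> r" "r < 2" "2 * exp (- (D / 2)) \<le> r" using D(1) by (auto simp: r_def)
  define c where "c = (2 - r) / 2"
  have c: "c > 0" using r by (simp add: c_def)
  \<comment> \<open>The bound \<open>D / 2\<close> keeps different fibres at distance at least
    \<open>D / 2\<close>; the bound \<open>c / 2\<close> gives \<open>c \<le> 2 - 2 * e - r\<close>,
    and this remaining \<open>c\<close> absorbs the cross terms.\<close>
  define e0 where "e0 = min (D / 2) (c / 2)"
  \<comment> \<open>The 1 pays for perturbing distances between base points, \<open>2 / c\<close>
    for AM-GM with at most two extra points, and \<open>C\<close> converts the l_1 norm into the
    form of \<open>X\<close>.\<close>
  define K where "K = C * (1 + 2 / c)"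
  have "e0 > 0" using D c by (simp add: e0_def)
  moreover have "(1 - K * e) * magnitude Y \<le> magnitude X"
    if Y: "finite_posdef_space Y" and p: "p ` mspace Y = mspace X" and dis: "distortion_le Y X p e"
      and card: "card (mspace Y) \<le> card (mspace X) + 2" and e: "0 \<le> e" "e \<le> e0"
    for Y :: "'b metric" and p e
  proof -
    let ?S = "mspace X" and ?T = "mspace Y"
    have finT: "finite ?T" using Y by (simp add: finite_posdef_space_def)
    obtain s where s: "s ` ?S \<subseteq> ?T" "\<And>x. x \<in> ?S \<Longrightarrow> p (s x) = x" and cardE: "card (?T - s ` ?S) \<le> 2"
      and opp: "\<And>e f. e \<in> ?T - s ` ?S \<Longrightarrow> f \<in> ?T - s ` ?S \<Longrightarrow> e \<noteq> f \<Longrightarrow> p e = p f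
        \<Longrightarrow> mdist Y e (s (p e)) \<le> mdist Y e f"
      using section_with_base_points[OF finT p card] by metis
    define E where "E = ?T - s ` ?S"
    have finE: "finite E" using finT by (simp add: E_def)
    have ET: "\<And>y. y \<in> E \<Longrightarrow> y \<in> ?T" by (simp add: E_def)
    have pS: "\<And>y. y \<in> ?T \<Longrightarrow> p y \<in> ?S" using p by auto
    have sT: "\<And>x. x \<in> ?S \<Longrightarrow> s x \<in> ?T" using s(1) by auto
    have bT: "s (p y) \<in> ?T" if "y \<in> ?T" for y using that pS sT by blast
    have dis': "\<bar>mdist X (p y) (p z) - mdist Y y z\<bar> \<le> e" if "y \<in> ?T" "z \<in> ?T" for y z
      using dis that by (simp add: distortion_le_def)
    define k where "k y z = exp (- mdist Y y z)" for y z
    have k_sym: "k y z = k z y" for y z by (simp add: k_def mdist_commute)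
    define \<delta> where "\<delta> y = mdist Y y (s (p y))" for y
    have \<delta>: "0 \<le> \<delta> y" "\<delta> y \<le> e" if "y \<in> ?T" for y
      using dis'[OF that bT[OF that]] s(2)[OF pS[OF that]] pS[OF that] by (auto simp: \<delta>_def mdist_self)
    have k_lip: "\<bar>k y z - k y (s (p z))\<bar> \<le> exp (- m) * \<delta> z"
      if "y \<in> ?T" "z \<in> ?T" "m \<le> mdist Y y z" "m \<le> mdist Y y (s (p z))" for y z m
    proof -
      have "\<bar>mdist Y y z - mdist Y y (s (p z))\<bar> \<le> \<delta> z"
        using mdist_triangle[of y Y z "s (p z)"] mdist_triangle[of y Y "s (p z)" z] that(1,2) bT[OF that(2)]
        by (simp add: \<delta>_def mdist_commute abs_le_iff)
      then have "exp (- m) * \<bar>mdist Y y z - mdist Y y (s (p z))\<bar> \<le> exp (- m) * \<delta> z"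
        by (rule mult_left_mono) simp
      from order_trans[OF exp_minus_lipschitz[OF that(3,4)] this] show ?thesis unfolding k_def .
    qed
    \<comment> \<open>The value of the form at the two differences of point masses
      \<open>y - s (p y)\<close> and \<open>z - s (p z)\<close>.\<close>
    define G where "G y z = (k y z - k y (s (p z))) - (k (s (p y)) z - k (s (p y)) (s (p z)))" for y z
    have G_sym: "G y z = G z y" for y z by (simp add: G_def k_sym)
    have G_diag: "(2 - 2 * e) * \<delta> y \<le> G y y" if "y \<in> E" for y
    proof -
      note y = ET[OF that]
      have "G y y = 2 * (1 - exp (- \<delta> y))"
        using y bT[OF y] by (simp add: G_def k_def \<delta>_def mdist_commute mdist_self)
      moreover have "e * \<delta> y \<ge> (\<delta> y)\<^sup>2"
        unfolding power2_eq_square by (intro mult_right_mono \<delta>[OF y])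
      ultimately show ?thesis using one_minus_exp_ge[OF \<delta>(1)[OF y]] by (simp add: algebra_simps)
    qed
    have G_off1: "\<bar>G y z\<bar> \<le> r * \<delta> z" if "y \<in> E" "z \<in> E" "y \<noteq> z" for y z
    proof (cases "p y = p z")
      case True
      note y = ET[OF that(1)] and z = ET[OF that(2)]
      \<comment> \<open>Both points share a base point, and
        \<open>0 \<le> G y z \<le> \<delta> z\<close> follows. The lower bound is the triangle
        inequality through the base point; the upper bound is \<open>opp\<close>, the choice of base
        point opposite a longest side.\<close>
      have "G y z = exp (- mdist Y y z) - exp (- \<delta> y) - exp (- \<delta> z) + 1"
        using y z bT[OF y] True by (simp add: G_def k_def \<delta>_def mdist_commute mdist_self)
      moreover have "exp (- mdist Y y z) \<le> exp (- \<delta> y)"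
        using opp[of y z] that True by (simp add: E_def \<delta>_def)
      moreover have "exp (- \<delta> y) * exp (- \<delta> z) \<le> exp (- mdist Y y z)"
        using mdist_triangle[of y Y "s (p y)" z] y z bT[OF y] True
        by (simp add: \<delta>_def mdist_commute flip: exp_add)
      moreover have "0 \<le> (1 - exp (- \<delta> y)) * (1 - exp (- \<delta> z))"
        using \<delta>(1)[OF y] \<delta>(1)[OF z] by (intro mult_nonneg_nonneg) auto
      then have "exp (- \<delta> y) + exp (- \<delta> z) \<le> 1 + exp (- \<delta> y) * exp (- \<delta> z)"
        by (simp add: algebra_simps)
      moreover have "1 - exp (- \<delta> z) \<le> \<delta> z" using exp_ge_add_one_self[of "- \<delta> z"] by linarith
      moreover have "\<delta> z \<le> r * \<delta> z" using mult_right_mono[OF r(1) \<delta>(1)[OF z]] by simp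
      ultimately show ?thesis by linarith
    next
      case False
      note y = ET[OF that(1)] and z = ET[OF that(2)]
      \<comment> \<open>All four distances in \<open>G y z\<close> are then at least
        \<open>D / 2\<close>, so each of its two differences is at most
        \<open>exp (- (D / 2)) * \<delta> z\<close>.\<close>
      have far: "D / 2 \<le> mdist Y a b" if "a \<in> ?T" "b \<in> ?T" "p a = p y" "p b = p z" for a b
        using D(2)[of "p y" "p z"] False pS[OF y] pS[OF z] dis'[OF that(1,2)] that(3,4) e(2)
        by (simp add: e0_def abs_le_iff)
      have "\<bar>G y z\<bar> \<le> \<bar>k y z - k y (s (p z))\<bar> + \<bar>k (s (p y)) z - k (s (p y)) (s (p z))\<bar>"
        unfolding G_def by linarith
      also have "\<dots> \<le> exp (- (D / 2)) * \<delta> z + exp (- (D / 2)) * \<delta> z"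
        using y z bT[OF y] bT[OF z] s(2)[OF pS[OF y]] s(2)[OF pS[OF z]]
        by (intro add_mono k_lip far) auto
      also have "\<dots> = (2 * exp (- (D / 2))) * \<delta> z" by simp
      also have "\<dots> \<le> r * \<delta> z" by (intro mult_right_mono r \<delta>(1) z)
      finally show ?thesis .
    qed
    have G_off: "\<bar>G y z\<bar> \<le> r * min (\<delta> y) (\<delta> z)" if "y \<in> E" "z \<in> E" "y \<noteq> z" for y z
      using G_off1[OF that] G_off1[OF that(2,1)] that(3) G_sym[of y z] by (auto simp: min_def)
    show ?thesis
    proof (rule magnitude_le_if_form_le[OF Y])
      fix v :: "'b \<Rightarrow> real"
      define V where "V x = (\<Sum>y | y \<in> ?T \<and> p y = x. v y)" for x
      define A where "A = (\<Sum>x\<in>?S. \<bar>V x\<bar>)"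
      have A0: "A \<ge> 0" by (simp add: A_def sum_nonneg)
      define Q where "Q = zeta_bilin ?S (mdist X) V V"
      have Q0: "Q \<ge> 0" unfolding Q_def using X by (simp add: finite_posdef_space_iff zeta_pos_nonneg)
      have split: "(\<Sum>y\<in>?T. v y * F y) = (\<Sum>x\<in>?S. V x * F (s x)) + (\<Sum>e\<in>E. v e * (F e - F (s (p e))))" for F
        unfolding V_def E_def by (rule sum_over_section) (use finT finS p s in auto)
      have sumV: "sum v ?T = sum V ?S" using split[of "\<lambda>_. 1"] by simp
      define X0 where "X0 = (\<Sum>x\<in>?S. \<Sum>f\<in>E. V x * v f * (k (s x) f - k (s x) (s (p f))))"
      have "zeta_bilin ?T (mdist Y) v v = (\<Sum>y\<in>?T. v y * (\<Sum>z\<in>?T. v z * k y z))"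
        by (simp add: zeta_bilin_def k_def sum_distrib_left mult_ac)
      \<comment> \<open>Both arguments are split, giving a base part, two mixed parts that both
        equal \<open>X0\<close>, and the form \<open>G\<close> on the differences.\<close>
      also have "\<dots> = (\<Sum>x\<in>?S. V x * ((\<Sum>x'\<in>?S. V x' * k (s x) (s x')) + (\<Sum>f\<in>E. v f * (k (s x) f - k (s x) (s (p f))))))
        + (\<Sum>y\<in>E. v y * (((\<Sum>x'\<in>?S. V x' * k y (s x')) + (\<Sum>f\<in>E. v f * (k y f - k y (s (p f)))))
           - ((\<Sum>x'\<in>?S. V x' * k (s (p y)) (s x')) + (\<Sum>f\<in>E. v f * (k (s (p y)) f - k (s (p y)) (s (p f)))))))"
        unfolding split[of "k _"] unfolding split ..
      also have "(\<Sum>x\<in>?S. V x * ((\<Sum>x'\<in>?S. V x' * k (s x) (s x')) + (\<Sum>f\<in>E. v f * (k (s x) f - k (s x) (s (p f))))))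
          = zeta_bilin ?S (\<lambda>x x'. mdist Y (s x) (s x')) V V + X0"
        by (simp add: X0_def zeta_bilin_def k_def distrib_left sum.distrib sum_distrib_left mult_ac)
      also have "(\<Sum>y\<in>E. v y * (((\<Sum>x'\<in>?S. V x' * k y (s x')) + (\<Sum>f\<in>E. v f * (k y f - k y (s (p f)))))
           - ((\<Sum>x'\<in>?S. V x' * k (s (p y)) (s x')) + (\<Sum>f\<in>E. v f * (k (s (p y)) f - k (s (p y)) (s (p f)))))))
          = (\<Sum>y\<in>E. v y * ((\<Sum>x\<in>?S. V x * (k y (s x) - k (s (p y)) (s x))) + (\<Sum>f\<in>E. v f * G y f)))"
        by (intro sum.cong refl) (simp add: G_def algebra_simps sum_subtractf sum.distrib)
      also have "\<dots> = (\<Sum>y\<in>E. \<Sum>x\<in>?S. v y * V x * (k y (s x) - k (s (p y)) (s x)))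
          + (\<Sum>y\<in>E. \<Sum>f\<in>E. v y * v f * G y f)"
        by (simp add: distrib_left sum.distrib sum_distrib_left mult_ac)
      also have "(\<Sum>y\<in>E. \<Sum>x\<in>?S. v y * V x * (k y (s x) - k (s (p y)) (s x))) = X0"
        unfolding X0_def
      proof (subst sum.swap, intro sum.cong refl)
        fix x y
        show "v y * V x * (k y (s x) - k (s (p y)) (s x)) = V x * v y * (k (s x) y - k (s x) (s (p y)))"
          using k_sym[of y "s x"] k_sym[of "s (p y)" "s x"] by simp
      qed
      finally have Qeq: "zeta_bilin ?T (mdist Y) v v = zeta_bilin ?S (\<lambda>x x'. mdist Y (s x) (s x')) V V + X0
        + (X0 + (\<Sum>y\<in>E. \<Sum>f\<in>E. v y * v f * G y f))" .
      have "\<bar>X0\<bar> \<le> (\<Sum>x\<in>?S. \<Sum>f\<in>E. \<bar>V x\<bar> * (\<delta> f * \<bar>v f\<bar>))"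
        unfolding X0_def
      proof (intro order.trans[OF sum_abs] sum_mono)
        fix x f assume x: "x \<in> ?S" and f: "f \<in> E"
        have "\<bar>k (s x) f - k (s x) (s (p f))\<bar> \<le> \<delta> f"
          using k_lip[of "s x" f 0] sT[OF x] ET[OF f] by simp
        then have "\<bar>V x * v f\<bar> * \<bar>k (s x) f - k (s x) (s (p f))\<bar> \<le> \<bar>V x * v f\<bar> * \<delta> f"
          by (intro mult_left_mono) auto
        then show "\<bar>V x * v f * (k (s x) f - k (s x) (s (p f)))\<bar> \<le> \<bar>V x\<bar> * (\<delta> f * \<bar>v f\<bar>)"
          by (simp add: abs_mult mult_ac)
      qed
      also have "\<dots> = A * (\<Sum>f\<in>E. \<delta> f * \<bar>v f\<bar>)" by (simp add: A_def sum_product)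
      finally have X0: "- X0 \<le> A * (\<Sum>f\<in>E. \<delta> f * \<bar>v f\<bar>)" by linarith
      \<comment> \<open>AM-GM: \<open>2 A t \<le> c t\<^sup>2 + A\<^sup>2 / c\<close>\<close>
      have "2 * (A * (\<Sum>f\<in>E. \<delta> f * \<bar>v f\<bar>)) = (\<Sum>f\<in>E. \<delta> f * (2 * A * \<bar>v f\<bar>))"
        by (simp add: sum_distrib_left mult_ac)
      also have "\<dots> \<le> (\<Sum>f\<in>E. c * (\<delta> f * (v f)\<^sup>2) + e * (A\<^sup>2 / c))"
      proof (rule sum_mono)
        fix f assume "f \<in> E"
        then have \<delta>f: "0 \<le> \<delta> f" "\<delta> f \<le> e" using \<delta> ET by auto
        have "0 \<le> (c * \<bar>v f\<bar> - A)\<^sup>2 / c" using c by simp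
        also have "\<dots> = c * (v f)\<^sup>2 + A\<^sup>2 / c - 2 * A * \<bar>v f\<bar>"
          using c by (simp add: field_simps power2_eq_square)
        finally have "\<delta> f * (2 * A * \<bar>v f\<bar>) \<le> \<delta> f * (c * (v f)\<^sup>2 + A\<^sup>2 / c)"
          using \<delta>f by (intro mult_left_mono) auto
        also have "\<dots> \<le> c * (\<delta> f * (v f)\<^sup>2) + e * (A\<^sup>2 / c)"
          using mult_right_mono[OF \<delta>f(2), of "A\<^sup>2 / c"] c by (simp add: algebra_simps)
        finally show "\<delta> f * (2 * A * \<bar>v f\<bar>) \<le> c * (\<delta> f * (v f)\<^sup>2) + e * (A\<^sup>2 / c)" .
      qed
      also have "\<dots> = c * (\<Sum>f\<in>E. \<delta> f * (v f)\<^sup>2) + card E * (e * (A\<^sup>2 / c))"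
        by (simp add: sum.distrib sum_distrib_left)
      also have "\<dots> \<le> c * (\<Sum>f\<in>E. \<delta> f * (v f)\<^sup>2) + 2 * (e * (A\<^sup>2 / c))"
        using cardE e c by (intro add_left_mono mult_right_mono) (auto simp: E_def)
      finally have X0': "- 2 * X0 \<le> c * (\<Sum>f\<in>E. \<delta> f * (v f)\<^sup>2) + 2 * (e * (A\<^sup>2 / c))"
        using X0 by linarith
      have "c * (\<Sum>f\<in>E. \<delta> f * (v f)\<^sup>2) \<le> (2 - 2 * e - r) * (\<Sum>f\<in>E. \<delta> f * (v f)\<^sup>2)"
        using e(2) \<delta> ET by (intro mult_right_mono sum_nonneg) (auto simp: c_def e0_def)
      also have "\<dots> \<le> (\<Sum>y\<in>E. \<Sum>f\<in>E. v y * v f * G y f)"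
        using finE cardE \<delta> ET G_diag G_off r(1) by (intro diagonally_dominant_form) (auto simp: E_def)
      finally have GG: "c * (\<Sum>f\<in>E. \<delta> f * (v f)\<^sup>2) \<le> (\<Sum>y\<in>E. \<Sum>f\<in>E. v y * v f * G y f)" .
      have "\<bar>zeta_bilin ?S (\<lambda>x x'. mdist Y (s x) (s x')) V V - zeta_bilin ?S (mdist X) V V\<bar> \<le> e * A\<^sup>2"
        unfolding A_def
      proof (rule zeta_bilin_perturb)
        fix x x' assume "x \<in> ?S" "x' \<in> ?S"
        then show "\<bar>mdist Y (s x) (s x') - mdist X x x'\<bar> \<le> e"
          using dis'[of "s x" "s x'"] sT s(2) by (simp add: abs_minus_commute)
      qed auto
      then have "Q - e * A\<^sup>2 \<le> zeta_bilin ?S (\<lambda>x x'. mdist Y (s x) (s x')) V V"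
        by (simp add: Q_def abs_le_iff)
      then have "Q - e * (1 + 2 / c) * A\<^sup>2 \<le> zeta_bilin ?T (mdist Y) v v"
        using Qeq X0' GG by (simp add: algebra_simps)
      moreover have "e * (1 + 2 / c) * A\<^sup>2 \<le> e * (1 + 2 / c) * (C * Q)"
        using C(2)[of V] e(1) c by (intro mult_left_mono) (auto simp: A_def Q_def)
      ultimately have "(1 - K * e) * Q \<le> zeta_bilin ?T (mdist Y) v v"
        by (simp add: K_def algebra_simps)
      moreover have "0 \<le> magnitude X"
        by (rule magnitude_nonneg[OF X])
      ultimately have 1: "magnitude X * ((1 - K * e) * Q) \<le> magnitude X * zeta_bilin ?T (mdist Y) v v"
        by (intro mult_left_mono)
      show "(1 - K * e) * (sum v ?T)\<^sup>2 \<le> magnitude X * zeta_bilin ?T (mdist Y) v v"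
      proof (cases "1 - K * e \<ge> 0")
        case True
        have "(1 - K * e) * (sum v ?T)\<^sup>2 \<le> (1 - K * e) * (magnitude X * Q)"
          unfolding sumV Q_def using True by (intro mult_left_mono sum_square_le_magnitude[OF X])
        with 1 show ?thesis by (simp add: mult_ac)
      next
        case False
        then have "(1 - K * e) * (sum v ?T)\<^sup>2 \<le> 0" by (simp add: mult_nonpos_nonneg)
        also have "0 \<le> magnitude X * zeta_bilin ?T (mdist Y) v v"
          using \<open>0 \<le> magnitude X\<close> Y by (simp add: finite_posdef_space_iff zeta_pos_nonneg)
        finally show ?thesis .
      qed
    next
      show "0 \<le> magnitude X"
        by (rule magnitude_nonneg[OF X])
    qed
  qed
  ultimately show ?thesis by (intro exI[of _ K] exI[of _ e0] conjI allI impI; (elim conjE)?) blast+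
qed

section \<open>Four points near a single point\<close>

definition psd_kernel :: "'a set \<Rightarrow> ('a \<Rightarrow> 'a \<Rightarrow> real) \<Rightarrow> bool" where
  "psd_kernel S K \<longleftrightarrow> (\<forall>v. 0 \<le> (\<Sum>x\<in>S. \<Sum>y\<in>S. K x y * v x * v y))"

text \<open>Defining multipliers by their action makes closure under products immediate, so sums of
  rank-one kernels are all that has to be exhibited. Acting on the constant kernel 1 shows that a
  multiplier is itself positive semidefinite.\<close>

definition schur_multiplier :: "'a set \<Rightarrow> ('a \<Rightarrow> 'a \<Rightarrow> real) \<Rightarrow> bool" where
  "schur_multiplier S K \<longleftrightarrow> (\<forall>J. psd_kernel S J \<longrightarrow> psd_kernel S (\<lambda>x y. K x y * J x y))"

lemma psd_kernel_cong:
  "(\<And>x y. x \<in> S \<Longrightarrow> y \<in> S \<Longrightarrow> K x y = K' x y) \<Longrightarrow> psd_kernel S K = psd_kernel S K'"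
  unfolding psd_kernel_def by simp

lemma schur_multiplier_cong:
  assumes "\<And>x y. x \<in> S \<Longrightarrow> y \<in> S \<Longrightarrow> K x y = K' x y"
  shows "schur_multiplier S K = schur_multiplier S K'"
proof -
  have "psd_kernel S (\<lambda>x y. K x y * J x y) = psd_kernel S (\<lambda>x y. K' x y * J x y)" for J
    by (rule psd_kernel_cong) (simp add: assms)
  then show ?thesis by (simp add: schur_multiplier_def)
qed

lemma schur_multiplier_rank_one: "schur_multiplier S (\<lambda>x y. g x * g y)"
  unfolding schur_multiplier_def
proof (intro allI impI)
  fix J assume J: "psd_kernel S J"
  show "psd_kernel S (\<lambda>x y. g x * g y * J x y)"
    unfolding psd_kernel_def
  proof
    fix v
    show "0 \<le> (\<Sum>x\<in>S. \<Sum>y\<in>S. g x * g y * J x y * v x * v y)"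
      using J[unfolded psd_kernel_def, rule_format, of "\<lambda>x. g x * v x"] by (simp add: mult_ac)
  qed
qed

lemma schur_multiplier_add:
  assumes "schur_multiplier S K" "schur_multiplier S K'"
  shows "schur_multiplier S (\<lambda>x y. K x y + K' x y)"
  unfolding schur_multiplier_def
proof (intro allI impI)
  fix J assume J: "psd_kernel S J"
  have "psd_kernel S (\<lambda>x y. K x y * J x y)" "psd_kernel S (\<lambda>x y. K' x y * J x y)"
    using assms J by (auto simp: schur_multiplier_def)
  then show "psd_kernel S (\<lambda>x y. (K x y + K' x y) * J x y)"
    by (simp add: psd_kernel_def distrib_right sum.distrib)
qed

lemma schur_multiplier_mult:
  assumes "schur_multiplier S K" "schur_multiplier S K'"
  shows "schur_multiplier S (\<lambda>x y. K x y * K' x y)"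
  using assms by (simp add: schur_multiplier_def mult.assoc)

lemma schur_multiplier_power:
  assumes "schur_multiplier S K"
  shows "schur_multiplier S (\<lambda>x y. K x y ^ n)"
proof (induction n)
  case 0
  show ?case using schur_multiplier_rank_one[of S "\<lambda>_. 1"] by simp
next
  case (Suc n)
  show ?case using schur_multiplier_mult[OF assms Suc] by simp
qed

lemma schur_multiplier_imp_psd:
  assumes "schur_multiplier S K"
  shows "psd_kernel S K"
proof -
  have "psd_kernel S (\<lambda>x y. 1)"
    unfolding psd_kernel_def
  proof
    fix v :: "'a \<Rightarrow> real"
    have "(\<Sum>x\<in>S. \<Sum>y\<in>S. 1 * v x * v y) = (sum v S)\<^sup>2"
      by (simp add: power2_eq_square sum_product)
    then show "0 \<le> (\<Sum>x\<in>S. \<Sum>y\<in>S. 1 * v x * v y)" by simp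
  qed
  then show ?thesis using assms[unfolded schur_multiplier_def, rule_format, of "\<lambda>x y. 1"] by simp
qed

text \<open>The kernel \<open>min (a x) (a y)\<close> is a sum of rank-one kernels of superlevel sets of \<open>a\<close>;
  each step of the induction splits off the lowest level.\<close>

lemma schur_multiplier_min:
  assumes "finite S" "\<And>x. x \<in> S \<Longrightarrow> 0 \<le> a x"
  shows "schur_multiplier S (\<lambda>x y. min (a x) (a y))"
  using assms(2)
proof (induction "card {x \<in> S. 0 < a x}" arbitrary: a rule: less_induct)
  case (less a)
  show ?case
  proof (cases "{x \<in> S. 0 < a x} = {}")
    case True
    then have "a x = 0" if "x \<in> S" for x using less.prems[OF that] that by force
    then have "schur_multiplier S (\<lambda>x y. min (a x) (a y)) = schur_multiplier S (\<lambda>x y. 0 * 0)"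
      by (intro schur_multiplier_cong) simp
    then show ?thesis using schur_multiplier_rank_one[of S "\<lambda>_. 0"] by simp
  next
    case False
    define P where "P = {x \<in> S. 0 < a x}"
    have P: "finite P" "P \<noteq> {}" using False assms(1) by (auto simp: P_def)
    define m where "m = Min (a ` P)"
    have "m \<in> a ` P" unfolding m_def using P by (intro Min_in) auto
    then obtain z where z: "z \<in> P" "a z = m" by auto
    have m: "m > 0" using z by (auto simp: P_def)
    have mle: "m \<le> a x" if "x \<in> P" for x unfolding m_def using P that by (intro Min_le) auto
    define a' where "a' x = max (a x - m) 0" for x
    have "{x \<in> S. 0 < a' x} \<subset> P"
    proof
      show "{x \<in> S. 0 < a' x} \<subseteq> P" using m by (auto simp: P_def a'_def)
      show "{x \<in> S. 0 < a' x} \<noteq> P" using z by (auto simp: a'_def)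
    qed
    then have "card {x \<in> S. 0 < a' x} < card {x \<in> S. 0 < a x}"
      using psubset_card_mono[OF P(1)] by (simp add: P_def)
    then have 1: "schur_multiplier S (\<lambda>x y. min (a' x) (a' y))"
      by (rule less.hyps) (simp add: a'_def)
    define g where "g x = (if x \<in> P then sqrt m else 0)" for x
    have "min (a x) (a y) = g x * g y + min (a' x) (a' y)" if xy: "x \<in> S" "y \<in> S" for x y
    proof -
      have "a u = 0 \<and> a' u = 0 \<and> g u = 0 \<or> a u \<ge> m \<and> a' u = a u - m \<and> g u = sqrt m" if "u \<in> S" for u
        using less.prems[OF that] mle[of u] m that by (auto simp: P_def a'_def g_def)
      from this[OF xy(1)] this[OF xy(2)] m show ?thesis by (auto simp: min_def)
    qed
    then have "schur_multiplier S (\<lambda>x y. min (a x) (a y))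
        = schur_multiplier S (\<lambda>x y. g x * g y + min (a' x) (a' y))"
      by (intro schur_multiplier_cong)
    then show ?thesis using schur_multiplier_add[OF schur_multiplier_rank_one 1] by simp
  qed
qed

text \<open>Once the least value is moved to 0, values \<open>a\<close>, \<open>b\<close> lie
  between 0 and \<open>e\<close>, and
  \<open>e - |a - b| = min a b + min (e - a) (e - b)\<close>.\<close>

lemma schur_multiplier_interval:
  assumes "finite S" "\<And>x y. x \<in> S \<Longrightarrow> y \<in> S \<Longrightarrow> \<bar>f x - f y\<bar> \<le> e"
  shows "schur_multiplier S (\<lambda>x y. e - \<bar>f x - f y\<bar>)"
proof (cases "S = {}")
  case True
  then show ?thesis by (simp add: schur_multiplier_def psd_kernel_def)
next
  case False
  define l where "l = Min (f ` S)"
  have "l \<in> f ` S" unfolding l_def using False assms(1) by (intro Min_in) auto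
  then obtain z where z: "z \<in> S" "f z = l" by auto
  have le: "l \<le> f x" if "x \<in> S" for x unfolding l_def using assms(1) that by (intro Min_le) auto
  have up: "f x - l \<le> e" if "x \<in> S" for x using assms(2)[OF that z(1)] z(2) by linarith
  have "e - \<bar>f x - f y\<bar> = min (f x - l) (f y - l) + min (e - (f x - l)) (e - (f y - l))" for x y
    by (auto simp: min_def abs_if)
  moreover have "schur_multiplier S (\<lambda>x y. min (f x - l) (f y - l))"
    by (rule schur_multiplier_min) (use assms(1) le in auto)
  moreover have "schur_multiplier S (\<lambda>x y. min (e - (f x - l)) (e - (f y - l)))"
    by (rule schur_multiplier_min) (use assms(1) up in auto)
  ultimately show ?thesis using schur_multiplier_add by simp
qed

text \<open>Powers of a multiplier are positive semidefinite, so all terms of the exponential series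
  contribute nonnegatively; the term of order 0 is the left-hand side.\<close>

lemma schur_multiplier_exp:
  fixes v :: "'a \<Rightarrow> real"
  assumes "schur_multiplier S K"
  shows "(sum v S)\<^sup>2 \<le> (\<Sum>x\<in>S. \<Sum>y\<in>S. exp (K x y) * v x * v y)"
proof -
  define F where "F n = (\<Sum>x\<in>S. \<Sum>y\<in>S. K x y ^ n /\<^sub>R fact n * v x * v y)" for n
  have sums: "F sums (\<Sum>x\<in>S. \<Sum>y\<in>S. exp (K x y) * v x * v y)"
    unfolding F_def by (intro sums_sum sums_mult2 exp_converges)
  have "0 \<le> F n" for n
  proof -
    have "0 \<le> (\<Sum>x\<in>S. \<Sum>y\<in>S. K x y ^ n * v x * v y)"
      using schur_multiplier_imp_psd[OF schur_multiplier_power[OF assms]] by (simp add: psd_kernel_def)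
    moreover have "F n = (\<Sum>x\<in>S. \<Sum>y\<in>S. K x y ^ n * v x * v y) /\<^sub>R fact n"
      by (simp add: F_def sum_distrib_left mult_ac)
    ultimately show ?thesis by simp
  qed
  then have "sum F {0} \<le> suminf F"
    using sums by (intro sum_le_suminf) (auto simp: sums_iff)
  moreover have "F 0 = (sum v S)\<^sup>2" by (simp add: F_def power2_eq_square sum_product)
  ultimately show ?thesis using sums by (simp add: sums_iff)
qed

text \<open>The kernel \<open>2 * e - d\<close> is a sum of two interval kernels, one per
  coordinate, and its exponential is the zeta kernel times \<open>exp (2 * e)\<close>.\<close>

lemma zeta_form_ge_if_l1_embeddable:
  assumes "finite S"
    and d: "\<And>x y. x \<in> S \<Longrightarrow> y \<in> S \<Longrightarrow> d x y = \<bar>f x - f y\<bar> + \<bar>g x - g y\<bar>"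
    and e: "\<And>x y. x \<in> S \<Longrightarrow> y \<in> S \<Longrightarrow> d x y \<le> e"
  shows "(sum v S)\<^sup>2 \<le> exp (2 * e) * zeta_bilin S d v v"
proof -
  have "schur_multiplier S (\<lambda>x y. (e - \<bar>f x - f y\<bar>) + (e - \<bar>g x - g y\<bar>))"
  proof (intro schur_multiplier_add schur_multiplier_interval assms(1))
    fix x y assume xy: "x \<in> S" "y \<in> S"
    show "\<bar>f x - f y\<bar> \<le> e" "\<bar>g x - g y\<bar> \<le> e" using d[OF xy] e[OF xy] by auto
  qed
  from schur_multiplier_exp[OF this, of v]
  have "(sum v S)\<^sup>2 \<le> (\<Sum>x\<in>S. \<Sum>y\<in>S. exp ((e - \<bar>f x - f y\<bar>) + (e - \<bar>g x - g y\<bar>)) * v x * v y)" .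
  also have "\<dots> = (\<Sum>x\<in>S. \<Sum>y\<in>S. exp (2 * e) * (exp (- d x y) * v x * v y))"
    by (intro sum.cong refl) (simp add: d mult.assoc algebra_simps flip: exp_add)
  also have "\<dots> = exp (2 * e) * zeta_bilin S d v v"
    by (simp add: zeta_bilin_def sum_distrib_left)
  finally show ?thesis .
qed

text \<open>For points \<open>p, q, r, s\<close> such that \<open>d p s + d q r\<close> is the largest of the three sums of
  opposite distances, \<open>F\<close> realises the distances along the path \<open>p, q, r, s\<close> and \<open>G\<close> those along
  \<open>r, p, s, q\<close>, so \<open>(F, G)\<close> is an isometric embedding into the plane with the maximum norm.\<close>

lemma ordered_four_point_l1_embedding:
  assumes S: "mspace Y = {p, q, r, s}" and dist: "distinct [p, q, r, s]"
    and m1: "mdist Y p q + mdist Y r s \<le> mdist Y p s + mdist Y q r"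
    and m2: "mdist Y p r + mdist Y q s \<le> mdist Y p s + mdist Y q r"
  shows "\<exists>f g. \<forall>x\<in>mspace Y. \<forall>y\<in>mspace Y. mdist Y x y = \<bar>f x - f y\<bar> + \<bar>(g x :: real) - g y\<bar>"
proof -
  let ?d = "mdist Y"
  define F where "F x = (if x = p then ?d p q else if x = q then 0 else if x = r then ?d q r else ?d q r - ?d r s)" for x
  define G where "G x = (if x = r then ?d p r else if x = p then 0 else if x = s then ?d p s else ?d p s - ?d q s)" for x
  have F: "F p = ?d p q" "F q = 0" "F r = ?d q r" "F s = ?d q r - ?d r s"
    and G: "G r = ?d p r" "G p = 0" "G s = ?d p s" "G q = ?d p s - ?d q s"
    using dist by (auto simp: F_def G_def)
  have mem: "p \<in> mspace Y" "q \<in> mspace Y" "r \<in> mspace Y" "s \<in> mspace Y" using S by auto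
  have comm: "?d q p = ?d p q" "?d r p = ?d p r" "?d s p = ?d p s" "?d r q = ?d q r" "?d s q = ?d q s" "?d s r = ?d r s"
    by (simp_all add: mdist_commute)
  have refl: "?d p p = 0" "?d q q = 0" "?d r r = 0" "?d s s = 0" using mem by auto
  note tri = mdist_triangle[OF mem(1,2,3)] mdist_triangle[OF mem(1,3,2)] mdist_triangle[OF mem(2,1,3)]
    mdist_triangle[OF mem(1,2,4)] mdist_triangle[OF mem(1,4,2)] mdist_triangle[OF mem(2,1,4)]
    mdist_triangle[OF mem(1,3,4)] mdist_triangle[OF mem(1,4,3)] mdist_triangle[OF mem(3,1,4)]
    mdist_triangle[OF mem(2,3,4)] mdist_triangle[OF mem(2,4,3)] mdist_triangle[OF mem(3,2,4)]
  note tri' = tri[unfolded comm]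
  \<comment> \<open>The pair \<open>(F + G) / 2\<close>, \<open>(F - G) / 2\<close> carries the
    maximum norm of the plane to the l_1 norm.\<close>
  define ok where "ok x y \<longleftrightarrow> ?d x y = \<bar>(F x + G x) / 2 - (F y + G y) / 2\<bar> + \<bar>(F x - G x) / 2 - (F y - G y) / 2\<bar>" for x y
  have max: "\<bar>(F x + G x) / 2 - (F y + G y) / 2\<bar> + \<bar>(F x - G x) / 2 - (F y - G y) / 2\<bar>
    = max \<bar>F x - F y\<bar> \<bar>G x - G y\<bar>" for x y by (simp add: max_def abs_if field_simps)
  \<comment> \<open>For each pair one of \<open>F\<close>, \<open>G\<close> realises the distance
    and the other must not exceed it. Besides triangle inequalities this takes \<open>m1\<close> for
    \<open>p, s\<close> and \<open>m2\<close> for \<open>q, r\<close>.\<close>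
  have okpq: "ok p q"
  proof -
    have "\<bar>?d p s - ?d q s\<bar> \<le> ?d p q" using tri' m1 m2 unfolding abs_le_iff by linarith
    then show ?thesis unfolding ok_def max unfolding F G using mdist_nonneg[of Y p q] by linarith
  qed
  have okpr: "ok p r"
  proof -
    have "\<bar>?d p q - ?d q r\<bar> \<le> ?d p r" using tri' m1 m2 unfolding abs_le_iff by linarith
    then show ?thesis unfolding ok_def max unfolding F G using mdist_nonneg[of Y p r] by linarith
  qed
  have okps: "ok p s"
  proof -
    have "\<bar>?d p q - (?d q r - ?d r s)\<bar> \<le> ?d p s" using tri' m1 m2 unfolding abs_le_iff by linarith
    then show ?thesis unfolding ok_def max unfolding F G using mdist_nonneg[of Y p s] by linarith
  qed
  have okqr: "ok q r"
  proof -
    have "\<bar>?d p s - ?d q s - ?d p r\<bar> \<le> ?d q r" using tri' m1 m2 unfolding abs_le_iff by linarith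
    then show ?thesis unfolding ok_def max unfolding F G using mdist_nonneg[of Y q r] by linarith
  qed
  have okqs: "ok q s"
  proof -
    have "\<bar>?d q r - ?d r s\<bar> \<le> ?d q s" using tri' m1 m2 unfolding abs_le_iff by linarith
    then show ?thesis unfolding ok_def max unfolding F G using mdist_nonneg[of Y q s] by linarith
  qed
  have okrs: "ok r s"
  proof -
    have "\<bar>?d p r - ?d p s\<bar> \<le> ?d r s" using tri' m1 m2 unfolding abs_le_iff by linarith
    then show ?thesis unfolding ok_def max unfolding F G using mdist_nonneg[of Y r s] by linarith
  qed
  note ok = okpq okpr okps okqr okqs okrs
  have ok_sym: "ok y x" if "ok x y" for x y
    using that mdist_commute[of Y x y] by (simp add: ok_def abs_minus_commute)
  have ok_refl: "ok p p" "ok q q" "ok r r" "ok s s" using refl by (simp_all add: ok_def)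
  have "\<forall>x\<in>mspace Y. \<forall>y\<in>mspace Y. ok x y"
    unfolding S using ok ok[THEN ok_sym] ok_refl by simp
  then show ?thesis unfolding ok_def
    by (intro exI[of _ "\<lambda>x. (F x + G x) / 2"] exI[of _ "\<lambda>x. (F x - G x) / 2"])
qed

text \<open>Four points split into two pairs in three ways; a relabelling moves the split with the
  largest sum of distances into the position of \<open>p, s\<close> and \<open>q, r\<close>.\<close>

lemma four_point_l1_embedding:
  assumes "card (mspace Y) = 4"
  shows "\<exists>f g. \<forall>x\<in>mspace Y. \<forall>y\<in>mspace Y. mdist Y x y = \<bar>f x - f y\<bar> + \<bar>(g x :: real) - g y\<bar>"
proof -
  let ?d = "mdist Y"
  obtain a B where B: "mspace Y = insert a B" "a \<notin> B" "card B = 3"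
    using assms card_eq_SucD[of "mspace Y" 3] by (auto simp: eval_nat_numeral)
  obtain b c d where "B = {b, c, d}" "b \<noteq> c" "b \<noteq> d" "c \<noteq> d"
    using B(3) unfolding card_3_iff by (elim exE conjE)
  then have S: "mspace Y = {a, b, c, d}" and dist: "distinct [a, b, c, d]" using B by simp_all
  have S': "mspace Y = {a, c, d, b}" "mspace Y = {a, b, d, c}" unfolding S by blast+
  have dist': "distinct [a, c, d, b]" "distinct [a, b, d, c]" using dist by auto
  have trichotomy: "A \<le> C \<and> B \<le> C \<or> C \<le> A \<and> B \<le> A \<or> A \<le> B \<and> C \<le> B" for A B C :: real by auto
  consider "?d a b + ?d c d \<le> ?d a d + ?d b c" "?d a c + ?d b d \<le> ?d a d + ?d b c"
    | "?d a d + ?d b c \<le> ?d a b + ?d c d" "?d a c + ?d b d \<le> ?d a b + ?d c d"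
    | "?d a b + ?d c d \<le> ?d a c + ?d b d" "?d a d + ?d b c \<le> ?d a c + ?d b d"
    using trichotomy[of "?d a b + ?d c d" "?d a d + ?d b c" "?d a c + ?d b d"] by blast
  then show ?thesis
  proof cases
    case 1
    then show ?thesis by (rule ordered_four_point_l1_embedding[OF S dist])
  next
    case 2
    then show ?thesis
      by (intro ordered_four_point_l1_embedding[OF S'(1) dist'(1)])
         (simp_all add: mdist_commute[of Y d b] mdist_commute[of Y c b])
  next
    case 3
    then show ?thesis
      by (intro ordered_four_point_l1_embedding[OF S'(2) dist'(2)])
         (simp_all add: mdist_commute[of Y d c])
  qed
qed

text \<open>The bound has the shape \<open>(1 - K * e) |Y| \<le> |X|\<close> with
  \<open>K = 2\<close> and \<open>|X| = 1\<close>, so it fits the same convergence argument as the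
  general upper bound.\<close>

lemma magnitude_four_points_le:
  assumes Y: "finite_posdef_space Y" "card (mspace Y) = 4"
    and e: "\<And>x y. x \<in> mspace Y \<Longrightarrow> y \<in> mspace Y \<Longrightarrow> mdist Y x y \<le> e"
  shows "(1 - 2 * e) * magnitude Y \<le> 1"
proof -
  obtain f g where fg: "\<forall>x\<in>mspace Y. \<forall>y\<in>mspace Y. mdist Y x y = \<bar>f x - f y\<bar> + \<bar>(g x :: real) - g y\<bar>"
    using four_point_l1_embedding[OF Y(2)] by auto
  have "1 * magnitude Y \<le> exp (2 * e)"
  proof (rule magnitude_le_if_form_le[OF Y(1)])
    fix v
    have "(sum v (mspace Y))\<^sup>2 \<le> exp (2 * e) * zeta_bilin (mspace Y) (mdist Y) v v"
      using Y(1) fg by (intro zeta_form_ge_if_l1_embeddable[OF _ _ e]) (simp_all add: finite_posdef_space_def)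
    then show "1 * (sum v (mspace Y))\<^sup>2 \<le> exp (2 * e) * zeta_bilin (mspace Y) (mdist Y) v v" by simp
  qed simp
  then have "exp (- (2 * e)) * magnitude Y \<le> exp (- (2 * e)) * exp (2 * e)"
    by (intro mult_left_mono) auto
  then have *: "exp (- (2 * e)) * magnitude Y \<le> 1" by (simp flip: exp_add)
  have "(1 - 2 * e) * magnitude Y \<le> exp (- (2 * e)) * magnitude Y"
    using exp_ge_add_one_self[of "- (2 * e)"] magnitude_nonneg[OF Y(1)] by (intro mult_right_mono) auto
  with * show ?thesis by linarith
qed

section \<open>Families of collapsing spaces\<close>

text \<open>The examples are built on natural numbers and carried by injections into arbitrary
  infinite point types.\<close>

definition push_metric :: "('a \<Rightarrow> 'b) \<Rightarrow> 'a metric \<Rightarrow> 'b metric" where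
  "push_metric h X = metric (h ` mspace X, \<lambda>x y. mdist X (the_inv h x) (the_inv h y))"

lemma
  assumes "inj h"
  shows mspace_push_metric: "mspace (push_metric h X) = h ` mspace X"
    and mdist_push_metric: "mdist (push_metric h X) (h x) (h y) = mdist X x y"
proof -
  interpret Metric_space "h ` mspace X" "\<lambda>x y. mdist X (the_inv h x) (the_inv h y)"
  proof
    show "0 \<le> mdist X (the_inv h x) (the_inv h y)" for x y by simp
    show "mdist X (the_inv h x) (the_inv h y) = mdist X (the_inv h y) (the_inv h x)" for x y by (rule mdist_commute)
    show "(mdist X (the_inv h x) (the_inv h y) = 0) = (x = y)" if "x \<in> h ` mspace X" "y \<in> h ` mspace X" for x y
      using that assms by (auto simp: the_inv_f_f inj_eq)
    show "mdist X (the_inv h x) (the_inv h z) \<le> mdist X (the_inv h x) (the_inv h y) + mdist X (the_inv h y) (the_inv h z)"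
      if "x \<in> h ` mspace X" "y \<in> h ` mspace X" "z \<in> h ` mspace X" for x y z
      using that assms by (auto simp: the_inv_f_f intro: mdist_triangle)
  qed
  show "mspace (push_metric h X) = h ` mspace X" by (simp add: push_metric_def)
  show "mdist (push_metric h X) (h x) (h y) = mdist X x y" using assms by (simp add: push_metric_def the_inv_f_f)
qed

lemma finite_posdef_space_push_metric:
  assumes "inj h" "finite_posdef_space X"
  shows "finite_posdef_space (push_metric h X)"
proof -
  have "zeta_bilin (h ` mspace X) (mdist (push_metric h X)) u v = zeta_bilin (mspace X) (mdist X) (u \<circ> h) (v \<circ> h)" for u v
    unfolding zeta_bilin_def using inj_on_subset[OF assms(1)]
    by (simp add: sum.reindex mdist_push_metric[OF assms(1)])
  then show ?thesis
    using assms(2) by (auto simp: finite_posdef_space_iff zeta_pos_def mspace_push_metric[OF assms(1)])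
qed

lemma magnitude_push_metric:
  assumes "inj h" "finite_posdef_space X"
  shows "magnitude (push_metric h X) = magnitude X"
proof -
  obtain w where w: "\<And>x. x \<in> mspace X \<Longrightarrow> (\<Sum>y\<in>mspace X. exp (- mdist X x y) * w y) = 1"
    "sum w (mspace X) = magnitude X"
    using magnitude_weighting[OF assms(2)] by auto
  have inj: "inj_on h (mspace X)" using assms(1) by (rule inj_on_subset) simp
  have "magnitude (push_metric h X) = sum (w \<circ> the_inv h) (mspace (push_metric h X))"
  proof (rule magnitude_eq_sum_weighting[OF finite_posdef_space_push_metric[OF assms]])
    fix x assume "x \<in> mspace (push_metric h X)"
    then obtain z where "x = h z" "z \<in> mspace X" by (auto simp: mspace_push_metric[OF assms(1)])
    then show "(\<Sum>y\<in>mspace (push_metric h X). exp (- mdist (push_metric h X) x y) * (w \<circ> the_inv h) y) = 1"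
      using w(1) inj assms(1)
      by (simp add: mspace_push_metric[OF assms(1)] mdist_push_metric[OF assms(1)] sum.reindex the_inv_f_f)
  qed
  also have "\<dots> = magnitude X"
    using w(2) inj assms(1) by (simp add: mspace_push_metric[OF assms(1)] sum.reindex the_inv_f_f)
  finally show ?thesis .
qed

text \<open>Both spaces are realised inside one copy of \<open>I\<close>, placed in the left summand
  of the ambient type, where every point is within \<open>\<rho>\<close> of
  \<open>A\<close>.\<close>

lemma GH_dist_push_submetric_le:
  fixes h :: "'c \<Rightarrow> 'b" and k :: "'c \<Rightarrow> 'a"
  assumes h: "inj h" and k: "inj k" and "mspace A \<subseteq> mspace I"
    and agree: "\<And>x y. x \<in> mspace A \<Longrightarrow> y \<in> mspace A \<Longrightarrow> mdist A x y = mdist I x y"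
    and near: "\<And>x. x \<in> mspace I \<Longrightarrow> \<exists>a\<in>mspace A. mdist I x a \<le> \<rho>"
  shows "GH_dist (push_metric h I) (push_metric k A) \<le> ennreal \<rho>"
proof -
  let ?Y = "push_metric h I" and ?X = "push_metric k A"
  define Z :: "('b + 'a) metric" where "Z = push_metric Inl ?Y"
  define g :: "'a \<Rightarrow> 'b + 'a" where "g x = Inl (h (the_inv k x))" for x
  have inl: "inj (Inl :: 'b \<Rightarrow> 'b + 'a)" by simp
  note m = mspace_push_metric[OF h] mspace_push_metric[OF k] mspace_push_metric[OF inl]
    mdist_push_metric[OF h] mdist_push_metric[OF k] mdist_push_metric[OF inl]
  have f: "isometric_embedding ?Y Z Inl"
    by (simp add: isometric_embedding_def Z_def m)
  have g: "isometric_embedding ?X Z g"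
    using assms(3) agree k by (auto simp: isometric_embedding_def Z_def m g_def the_inv_f_f)
  have gim: "g ` mspace ?X = (\<lambda>a. Inl (h a)) ` mspace A"
    using k by (auto simp: g_def m the_inv_f_f image_iff)
  have fim: "Inl ` mspace ?Y = (\<lambda>a. Inl (h a) :: 'b + 'a) ` mspace I"
    by (auto simp: m)
  have Zd: "mdist Z (Inl (h x)) (Inl (h y)) = mdist I x y" for x y by (simp add: Z_def m)
  have "Hausdorff_dist Z (Inl ` mspace ?Y) (g ` mspace ?X) \<le> ennreal \<rho>"
    unfolding Hausdorff_dist_def fim gim
  proof (intro max.boundedI SUP_least)
    fix z :: "'b + 'a" assume "z \<in> (\<lambda>a. Inl (h a)) ` mspace I"
    then obtain x where x: "z = Inl (h x)" "x \<in> mspace I" by auto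
    then obtain a where a: "a \<in> mspace A" "mdist I x a \<le> \<rho>" using near by auto
    show "(INF b\<in>(\<lambda>a. Inl (h a)) ` mspace A. ennreal (mdist Z z b)) \<le> ennreal \<rho>"
      by (rule INF_lower2[of "Inl (h a)"]) (use a x in \<open>auto simp: Zd ennreal_leI\<close>)
  next
    fix z :: "'b + 'a" assume "z \<in> (\<lambda>a. Inl (h a)) ` mspace A"
    then obtain x where x: "z = Inl (h x)" "x \<in> mspace A" by auto
    then have xI: "x \<in> mspace I" using assms(3) by auto
    then obtain a where "mdist I x a \<le> \<rho>" using near by auto
    then have "0 \<le> \<rho>" using mdist_nonneg[of I x a] by linarith
    then show "(INF a\<in>(\<lambda>a. Inl (h a)) ` mspace I. ennreal (mdist Z a z)) \<le> ennreal \<rho>"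
      by (intro INF_lower2[of "Inl (h x)"]) (use x xI in \<open>auto simp: Zd mdist_self intro!: ennreal_leI\<close>)
  qed
  moreover have "GH_dist ?Y ?X \<le> Hausdorff_dist Z (Inl ` mspace ?Y) (g ` mspace ?X)"
    unfolding GH_dist_def using f g by (intro Inf_lower) auto
  ultimately show ?thesis by (rule order_trans[rotated])
qed

lemma zeta_pos_subset:
  assumes "zeta_pos S d" "T \<subseteq> S" "finite S"
  shows "zeta_pos T d"
  unfolding zeta_pos_def
proof (intro allI impI)
  fix u :: "'a \<Rightarrow> real" assume u: "\<exists>x\<in>T. u x \<noteq> 0"
  define v where "v x = (if x \<in> T then u x else 0)" for x
  have "\<exists>x\<in>S. v x \<noteq> 0" using u assms(2) by (auto simp: v_def)
  then have "0 < zeta_bilin S d v v" using assms(1) by (simp add: zeta_pos_def)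
  also have "zeta_bilin S d v v = (\<Sum>x\<in>T. \<Sum>y\<in>S. exp (- d x y) * v x * v y)"
    unfolding zeta_bilin_def by (rule sum.mono_neutral_right) (use assms in \<open>auto simp: v_def\<close>)
  also have "\<dots> = (\<Sum>x\<in>T. \<Sum>y\<in>T. exp (- d x y) * v x * v y)"
    by (intro sum.cong refl sum.mono_neutral_right) (use assms in \<open>auto simp: v_def\<close>)
  also have "\<dots> = zeta_bilin T d u u" by (simp add: zeta_bilin_def v_def)
  finally show "0 < zeta_bilin T d u u" .
qed

text \<open>This reduces a counterexample to explicit data: distances within \<open>A\<close> stay
  fixed, the other points of \<open>I\<close> are drawn to \<open>A\<close>, and weightings give
  both magnitudes. The bound \<open>c\<close> is uniform in \<open>n\<close>, so it survives the
  limit.\<close>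

lemma discontinuity_from_kernels:
  fixes D :: "nat \<Rightarrow> nat \<Rightarrow> nat \<Rightarrow> real"
  assumes fin: "finite I" and "A \<subseteq> I"
    and met: "\<And>n. Metric_space I (D n)" and pos: "\<And>n. zeta_pos I (D n)"
    and agree: "\<And>n x y. x \<in> A \<Longrightarrow> y \<in> A \<Longrightarrow> D n x y = D 0 x y"
    and near: "\<And>n x. x \<in> I \<Longrightarrow> \<exists>a\<in>A. D n x a \<le> \<rho> n" and "\<rho> \<longlonglongrightarrow> 0"
    and w: "\<And>n x. x \<in> I \<Longrightarrow> (\<Sum>y\<in>I. exp (- D n x y) * w n y) = 1"
    and wA: "\<And>x. x \<in> A \<Longrightarrow> (\<Sum>y\<in>A. exp (- D 0 x y) * wA y) = 1"
    and gap: "\<And>n. c \<le> sum (w n) I" "sum wA A < c"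
  shows "\<exists>(X :: 'a::infinite metric) (Y :: nat \<Rightarrow> 'b::infinite metric).
    finite_posdef_space X \<and> card (mspace X) = card A \<and>
    (\<forall>n. finite_posdef_space (Y n) \<and> card (mspace (Y n)) = card I) \<and>
    (\<lambda>n. GH_dist (Y n) X) \<longlonglongrightarrow> 0 \<and> \<not> (\<lambda>n. magnitude (Y n)) \<longlonglongrightarrow> magnitude X"
proof -
  obtain h :: "nat \<Rightarrow> 'b" where h: "inj h"
    using infinite_countable_subset[OF infinite_UNIV] by blast
  obtain k :: "nat \<Rightarrow> 'a" where k: "inj k"
    using infinite_countable_subset[OF infinite_UNIV] by blast
  define MI where "MI n = metric (I, D n)" for n
  define MA where "MA = metric (A, D 0)"
  have metA: "Metric_space A (D 0)" using Metric_space.subspace[OF met assms(2)] .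
  have MI: "mspace (MI n) = I" "mdist (MI n) = D n" for n
    using Metric_space.mspace_metric[OF met] Metric_space.mdist_metric[OF met] by (auto simp: MI_def)
  have MA: "mspace MA = A" "mdist MA = D 0"
    using Metric_space.mspace_metric[OF metA] Metric_space.mdist_metric[OF metA] by (auto simp: MA_def)
  have finA: "finite A" using fin assms(2) by (rule rev_finite_subset)
  have posI: "finite_posdef_space (MI n)" for n using fin pos by (simp add: finite_posdef_space_iff MI)
  have posA: "finite_posdef_space MA"
    using finA zeta_pos_subset[OF pos[of 0] assms(2) fin] by (simp add: finite_posdef_space_iff MA)
  have magI: "magnitude (MI n) = sum (w n) I" for n
    using magnitude_eq_sum_weighting[OF posI[of n], of "w n"] w by (simp add: MI)
  have magA: "magnitude MA = sum wA A"
    using magnitude_eq_sum_weighting[OF posA, of wA] wA by (simp add: MA)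
  let ?X = "push_metric k MA" and ?Y = "\<lambda>n. push_metric h (MI n)"
  have GH: "GH_dist (?Y n) ?X \<le> ennreal (\<rho> n)" for n
  proof (rule GH_dist_push_submetric_le[OF h k])
    show "mspace MA \<subseteq> mspace (MI n)" using assms(2) by (simp add: MI MA)
    show "mdist MA x y = mdist (MI n) x y" if "x \<in> mspace MA" "y \<in> mspace MA" for x y
      using agree[of x y n] that by (simp add: MI MA)
    show "\<exists>a\<in>mspace MA. mdist (MI n) x a \<le> \<rho> n" if "x \<in> mspace (MI n)" for x
      using near[of x n] that by (simp add: MI MA)
  qed
  have "(\<lambda>n. ennreal (\<rho> n)) \<longlonglongrightarrow> 0" using tendsto_ennrealI[OF \<open>\<rho> \<longlonglongrightarrow> 0\<close>] by simp
  then have "(\<lambda>n. GH_dist (?Y n) ?X) \<longlonglongrightarrow> 0"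
    by (rule tendsto_sandwich[OF _ _ tendsto_const, rotated -1]) (use GH in auto)
  moreover have "\<not> (\<lambda>n. magnitude (?Y n)) \<longlonglongrightarrow> magnitude ?X"
  proof
    assume "(\<lambda>n. magnitude (?Y n)) \<longlonglongrightarrow> magnitude ?X"
    then have "c \<le> magnitude ?X"
      by (rule LIMSEQ_le_const) (use gap in \<open>auto simp: magnitude_push_metric[OF h posI] magI\<close>)
    then show False using gap(2) by (simp add: magnitude_push_metric[OF k posA] magA)
  qed
  moreover have "card (mspace ?X) = card A" "\<And>n. card (mspace (?Y n)) = card I"
    using h k by (auto simp: mspace_push_metric MA MI card_image inj_on_subset)
  ultimately show ?thesis
    using finite_posdef_space_push_metric[OF k posA] finite_posdef_space_push_metric[OF h posI]
    by (intro exI[of _ ?X] exI[of _ ?Y]) blast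
qed

section \<open>Five points collapsing to one\<close>

text \<open>The clusters are 0, 1, 2 and 3, 4. With \<open>s = exp (- t)\<close> all entries are
  powers of \<open>s\<close>, and \<open>6 * t\<close> is the largest distance that two steps of
  \<open>3 * t\<close> allow.\<close>

definition two_cluster_dist :: "real \<Rightarrow> nat \<Rightarrow> nat \<Rightarrow> real" where
  "two_cluster_dist t i j = (if i = j then 0 else if i < 3 \<and> j < 3 then 6 * t
     else if 3 \<le> i \<and> 3 \<le> j then 4 * t else 3 * t)"

lemma Metric_space_two_cluster_dist:
  assumes "t > 0"
  shows "Metric_space I (two_cluster_dist t)"
proof
  fix x y z
  show "0 \<le> two_cluster_dist t x y" "two_cluster_dist t x y = two_cluster_dist t y x"
    "(two_cluster_dist t x y = 0) = (x = y)"
    using assms by (auto simp: two_cluster_dist_def)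
  show "two_cluster_dist t x z \<le> two_cluster_dist t x y + two_cluster_dist t y z"
    using assms by (simp add: two_cluster_dist_def)
qed

lemma exp_minus_numeral_mult:
  "exp (- (numeral n * t)) = exp (- t :: real) ^ numeral n"
  using exp_of_nat_mult[of "numeral n" "- t"] by simp

lemma lessThan_5: "{..<5 :: nat} = {0, 1, 2, 3, 4}"
  by auto

lemma exp_minus_two_cluster_dist:
  assumes "s = exp (- t)"
  shows "exp (- two_cluster_dist t i j) = (if i = j then 1 else if i < 3 \<and> j < 3 then s ^ 6
     else if 3 \<le> i \<and> 3 \<le> j then s ^ 4 else s ^ 3)"
  by (simp add: two_cluster_dist_def assms exp_minus_numeral_mult)

text \<open>The left side is \<open>(1 + s^4) (1 + 2 s^6) - 6 s^6\<close>, the determinant of the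
  system for weights constant on clusters. The factorisation shows its sign for
  \<open>0 < s < 1\<close>.\<close>

lemma two_cluster_det:
  "1 + s ^ 4 - 4 * s ^ 6 + 2 * s ^ 10 = (1 - s\<^sup>2)\<^sup>2 * (1 + 2 * s\<^sup>2 + 4 * s ^ 4 + 2 * s ^ 6)"
  for s :: real
  by (simp add: algebra_simps power_numeral_reduce)

text \<open>The form consists of squares of differences within clusters and a binary form in the
  cluster sums \<open>\<sigma>\<close>, \<open>\<tau>\<close>, in which the square is
  completed.\<close>

lemma zeta_pos_two_cluster_dist:
  assumes "t > 0"
  shows "zeta_pos {..<5} (two_cluster_dist t)"
  unfolding zeta_pos_def
proof (intro allI impI)
  fix v :: "nat \<Rightarrow> real" assume nz: "\<exists>x\<in>{..<5}. v x \<noteq> 0"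
  define s where "s = exp (- t)"
  have s: "0 < s" "s < 1" using assms by (auto simp: s_def)
  define x1 x2 x3 y1 y2 where v: "x1 = v 0" "x2 = v 1" "x3 = v 2" "y1 = v 3" "y2 = v 4"
  define \<sigma> \<tau> where "\<sigma> = x1 + x2 + x3" and "\<tau> = y1 + y2"
  define A where "A = (1 + 2 * s ^ 6) / 3"
  \<comment> \<open>What remains of the coefficient of \<open>\<tau>^2\<close> after completing the
    square; the numerator is the determinant above.\<close>
  define B where "B = (1 + s ^ 4 - 4 * s ^ 6 + 2 * s ^ 10) / (2 * (1 + 2 * s ^ 6))"
  have den: "0 < 1 + 2 * s ^ 6" using s by (simp add: add_pos_pos)
  have A: "A > 0" using den by (simp add: A_def)
  have "s\<^sup>2 < 1" "s ^ 4 < 1" "s ^ 6 < 1" using s by (simp_all add: power_less_one_iff)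
  then have c: "0 < 1 - s ^ 6" "0 < 1 - s ^ 4" "0 < (1 - s\<^sup>2)\<^sup>2" by auto
  have "0 < 1 + 2 * s\<^sup>2 + 4 * s ^ 4 + 2 * s ^ 6" using s by (simp add: add_pos_pos)
  then have "0 < 1 + s ^ 4 - 4 * s ^ 6 + 2 * s ^ 10"
    unfolding two_cluster_det using c(3) by (rule mult_pos_pos[rotated])
  then have B: "B > 0" using den by (simp add: B_def)
  have "zeta_bilin {..<5} (two_cluster_dist t) v v = (x1\<^sup>2 + x2\<^sup>2 + x3\<^sup>2) + 2 * s ^ 6 * (x1 * x2 + x1 * x3 + x2 * x3)
      + (y1\<^sup>2 + y2\<^sup>2) + 2 * s ^ 4 * (y1 * y2) + 2 * s ^ 3 * (\<sigma> * \<tau>)"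
    unfolding zeta_bilin_def lessThan_5 exp_minus_two_cluster_dist[OF s_def] v \<sigma>_def \<tau>_def
    by (simp add: algebra_simps power2_eq_square)
  also have "\<dots> = (1 - s ^ 6) / 3 * ((x1 - x2)\<^sup>2 + (x1 - x3)\<^sup>2 + (x2 - x3)\<^sup>2)
      + (1 - s ^ 4) / 2 * (y1 - y2)\<^sup>2 + (A * \<sigma>\<^sup>2 + (1 + s ^ 4) / 2 * \<tau>\<^sup>2 + 2 * s ^ 3 * (\<sigma> * \<tau>))"
    by (simp add: A_def \<sigma>_def \<tau>_def field_simps power2_eq_square)
  also have "A * \<sigma>\<^sup>2 + (1 + s ^ 4) / 2 * \<tau>\<^sup>2 + 2 * s ^ 3 * (\<sigma> * \<tau>) = (A * \<sigma> + s ^ 3 * \<tau>)\<^sup>2 / A + B * \<tau>\<^sup>2"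
  proof -
    have *: "x / (D / 3) + y / (2 * D) = (6 * x + y) / (2 * D)" if "D > 0" for x y D :: real
      using that by (simp add: field_simps)
    have "(s ^ 3)\<^sup>2 / A + B = (6 * s ^ 6 + (1 + s ^ 4 - 4 * s ^ 6 + 2 * s ^ 10)) / (2 * (1 + 2 * s ^ 6))"
      using *[OF den, of "s ^ 6"] unfolding A_def B_def by (simp only: flip: power_mult) simp
    also have "6 * s ^ 6 + (1 + s ^ 4 - 4 * s ^ 6 + 2 * s ^ 10) = (1 + s ^ 4) * (1 + 2 * s ^ 6)"
      by (simp add: algebra_simps flip: power_add)
    also have "(1 + s ^ 4) * (1 + 2 * s ^ 6) / (2 * (1 + 2 * s ^ 6)) = (1 + s ^ 4) / 2"
      by (rule nonzero_mult_divide_mult_cancel_right) (use den in simp)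
    finally have "(1 + s ^ 4) / 2 = (s ^ 3)\<^sup>2 / A + B" by (rule sym)
    show ?thesis unfolding \<open>(1 + s ^ 4) / 2 = _\<close> using A by (simp add: field_simps power2_eq_square)
  qed
  finally have Q: "zeta_bilin {..<5} (two_cluster_dist t) v v =
    (1 - s ^ 6) / 3 * ((x1 - x2)\<^sup>2 + (x1 - x3)\<^sup>2 + (x2 - x3)\<^sup>2)
      + (1 - s ^ 4) / 2 * (y1 - y2)\<^sup>2 + ((A * \<sigma> + s ^ 3 * \<tau>)\<^sup>2 / A + B * \<tau>\<^sup>2)" .
  have nonneg: "0 \<le> (1 - s ^ 6) / 3 * ((x1 - x2)\<^sup>2 + (x1 - x3)\<^sup>2 + (x2 - x3)\<^sup>2)"
    "0 \<le> (1 - s ^ 4) / 2 * (y1 - y2)\<^sup>2" "0 \<le> (A * \<sigma> + s ^ 3 * \<tau>)\<^sup>2 / A" "0 \<le> B * \<tau>\<^sup>2"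
    using c A B by simp_all
  show "0 < zeta_bilin {..<5} (two_cluster_dist t) v v"
  proof (rule ccontr)
    assume "\<not> ?thesis"
    then have zero: "(1 - s ^ 6) / 3 * ((x1 - x2)\<^sup>2 + (x1 - x3)\<^sup>2 + (x2 - x3)\<^sup>2) = 0"
      "(1 - s ^ 4) / 2 * (y1 - y2)\<^sup>2 = 0" "(A * \<sigma> + s ^ 3 * \<tau>)\<^sup>2 / A = 0" "B * \<tau>\<^sup>2 = 0"
      unfolding Q using nonneg by linarith+
    have "(x1 - x2)\<^sup>2 + (x1 - x3)\<^sup>2 + (x2 - x3)\<^sup>2 = 0" using zero(1) c by simp
    then have "x1 = x2" "x1 = x3"
      using zero_le_power2[of "x1 - x2"] zero_le_power2[of "x1 - x3"] zero_le_power2[of "x2 - x3"]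
      by (smt (verit) power2_eq_iff_nonneg power_zero_numeral zero_eq_power2)+
    moreover have "y1 = y2" using zero(2) c by simp
    moreover have "\<tau> = 0" using zero(4) B by simp
    moreover have "\<sigma> = 0" using zero(3) A \<open>\<tau> = 0\<close> by simp
    ultimately have "x1 = 0" "x2 = 0" "x3 = 0" "y1 = 0" "y2 = 0" by (auto simp: \<sigma>_def \<tau>_def)
    then show False using nz unfolding lessThan_5 v by auto
  qed
qed

lemma weighting_two_cluster_dist:
  assumes "t > 0"
  shows "\<exists>w. (\<forall>x\<in>{..<5}. (\<Sum>y\<in>{..<5}. exp (- two_cluster_dist t x y) * w y) = 1) \<and> 7 / 6 \<le> sum w {..<5}"
proof -
  define s where "s = exp (- t)"
  have s: "0 < s" "s < 1" using assms by (auto simp: s_def)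
  define \<Delta> where "\<Delta> = 1 + s ^ 4 - 4 * s ^ 6 + 2 * s ^ 10"
  have "s\<^sup>2 < 1" using s by (simp add: power_less_one_iff)
  then have "0 < (1 - s\<^sup>2)\<^sup>2" by auto
  moreover have "0 < 1 + 2 * s\<^sup>2 + 4 * s ^ 4 + 2 * s ^ 6" using s by (simp add: add_pos_pos)
  ultimately have \<Delta>: "\<Delta> > 0" unfolding \<Delta>_def two_cluster_det by (rule mult_pos_pos)
  \<comment> \<open>Cramer's rule for weights \<open>a\<close> on the cluster of three and
    \<open>b\<close> on the cluster of two.\<close>
  define a where "a = (1 + s ^ 4 - 2 * s ^ 3) / \<Delta>"
  define b where "b = (1 + 2 * s ^ 6 - 3 * s ^ 3) / \<Delta>"
  have eq1: "(1 + 2 * s ^ 6) * a + 2 * s ^ 3 * b = 1"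
  proof -
    have "(1 + 2 * s ^ 6) * (1 + s ^ 4 - 2 * s ^ 3) + 2 * s ^ 3 * (1 + 2 * s ^ 6 - 3 * s ^ 3) = \<Delta>"
      unfolding \<Delta>_def by (simp add: algebra_simps flip: power_add)
    then show ?thesis using \<Delta> by (simp add: a_def b_def flip: add_divide_distrib)
  qed
  have eq2: "3 * s ^ 3 * a + (1 + s ^ 4) * b = 1"
  proof -
    have "3 * s ^ 3 * (1 + s ^ 4 - 2 * s ^ 3) + (1 + s ^ 4) * (1 + 2 * s ^ 6 - 3 * s ^ 3) = \<Delta>"
      unfolding \<Delta>_def by (simp add: algebra_simps flip: power_add)
    then show ?thesis using \<Delta> by (simp add: a_def b_def flip: add_divide_distrib)
  qed
  define w where "w i = (if i < (3 :: nat) then a else b)" for i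
  have "(\<Sum>y\<in>{..<5}. exp (- two_cluster_dist t x y) * w y) = 1" if "x \<in> {..<5}" for x
    using that eq1 eq2 unfolding lessThan_5 exp_minus_two_cluster_dist[OF s_def] w_def
    by (auto simp: algebra_simps)
  moreover have "7 / 6 \<le> sum w {..<5}"
  proof -
    have mono: "s ^ n \<le> s ^ m" if "m \<le> n" for m n using s that by (intro power_decreasing) auto
    \<comment> \<open>The cofactor of \<open>(1 - s)^2\<close> in the polynomial to be shown
      nonnegative. Its coefficients add up to 0 and the negative ones belong to the higher powers of
      \<open>s\<close>. The constant \<open>7 / 6\<close> is the limit of the total weight as
      \<open>s\<close> tends to 1.\<close>
    have "0 \<le> 23 + 46 * s + 69 * s\<^sup>2 + 20 * s ^ 3 - 18 * s ^ 4 - 56 * s ^ 5 - 42 * s ^ 6 - 28 * s ^ 7 - 14 * s ^ 8"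
      using mono[of 0 8] mono[of 0 7] mono[of 1 7] mono[of 1 6] mono[of 2 6] mono[of 2 5] mono[of 2 4] mono[of 3 5] mono[of 3 4] mono[of 1 5] mono[of 2 3]
      by simp
    then have "0 \<le> (1 - s)\<^sup>2 * (23 + 46 * s + 69 * s\<^sup>2 + 20 * s ^ 3 - 18 * s ^ 4 - 56 * s ^ 5 - 42 * s ^ 6 - 28 * s ^ 7 - 14 * s ^ 8)"
      by (intro mult_nonneg_nonneg) auto
    also have "\<dots> = 6 * (5 - 12 * s ^ 3 + 3 * s ^ 4 + 4 * s ^ 6) - 7 * \<Delta>"
      unfolding \<Delta>_def by (simp add: algebra_simps power_numeral_reduce)
    finally have "7 / 6 \<le> (5 - 12 * s ^ 3 + 3 * s ^ 4 + 4 * s ^ 6) / \<Delta>"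
      using \<Delta> by (simp add: field_simps)
    also have "\<dots> = sum w {..<5}"
      unfolding lessThan_5 w_def a_def b_def using \<Delta> by (simp add: field_simps)
    finally show ?thesis .
  qed
  ultimately show ?thesis by blast
qed

section \<open>Adding equidistant points\<close>

definition join_dist :: "'a set \<Rightarrow> ('a \<Rightarrow> 'a \<Rightarrow> real) \<Rightarrow> real \<Rightarrow> 'a \<Rightarrow> 'a \<Rightarrow> real" where
  "join_dist B d \<sigma> x y = (if x = y then 0 else if x \<in> B \<and> y \<in> B then d x y else \<sigma>)"

text \<open>A path between base points through an extra point has length
  \<open>2 * \<sigma>\<close>, hence the bound on \<open>d\<close>.\<close>

lemma Metric_space_join_dist:
  assumes "Metric_space B d" "0 < \<sigma>" "\<And>x y. x \<in> B \<Longrightarrow> y \<in> B \<Longrightarrow> d x y \<le> 2 * \<sigma>"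
  shows "Metric_space I (join_dist B d \<sigma>)"
proof
  interpret Metric_space B d by fact
  fix x y z
  show "0 \<le> join_dist B d \<sigma> x y" using assms(2) by (simp add: join_dist_def)
  show "join_dist B d \<sigma> x y = join_dist B d \<sigma> y x" by (auto simp: join_dist_def commute)
  show "(join_dist B d \<sigma> x y = 0) = (x = y)" using assms(2) by (auto simp: join_dist_def)
  show "join_dist B d \<sigma> x z \<le> join_dist B d \<sigma> x y + join_dist B d \<sigma> y z"
    using assms(2) assms(3)[of x z] nonneg[of x y] nonneg[of y z] nonneg[of x z] triangle[of x y z]
    by (auto simp: join_dist_def)
qed

context
  fixes B E :: "'a set" and d :: "'a \<Rightarrow> 'a \<Rightarrow> real" and \<sigma> r :: real
  assumes fin: "finite B" "finite E" and disj: "B \<inter> E = {}"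
    and diag: "\<And>x. x \<in> B \<Longrightarrow> d x x = 0" and r: "r = exp (- \<sigma>)"
begin

lemma sum_join_base:
  assumes "x \<in> B"
  shows "(\<Sum>y\<in>B \<union> E. exp (- join_dist B d \<sigma> x y) * f y) = (\<Sum>y\<in>B. exp (- d x y) * f y) + r * sum f E"
proof -
  have "(\<Sum>y\<in>B. exp (- join_dist B d \<sigma> x y) * f y) = (\<Sum>y\<in>B. exp (- d x y) * f y)"
    using assms diag by (intro sum.cong) (auto simp: join_dist_def)
  moreover have "(\<Sum>y\<in>E. exp (- join_dist B d \<sigma> x y) * f y) = r * sum f E"
    unfolding sum_distrib_left using assms disj by (intro sum.cong) (auto simp: join_dist_def r)
  ultimately show ?thesis using fin disj by (simp add: sum.union_disjoint)
qed

lemma sum_join_extra: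
  assumes "x \<in> E"
  shows "(\<Sum>y\<in>B \<union> E. exp (- join_dist B d \<sigma> x y) * f y) = r * sum f B + r * sum f E + (1 - r) * f x"
proof -
  have "(\<Sum>y\<in>B. exp (- join_dist B d \<sigma> x y) * f y) = r * sum f B"
    unfolding sum_distrib_left using assms disj by (intro sum.cong) (auto simp: join_dist_def r)
  moreover have "(\<Sum>y\<in>E. exp (- join_dist B d \<sigma> x y) * f y) = (\<Sum>y\<in>E. r * f y + (if y = x then (1 - r) * f y else 0))"
    using assms disj by (intro sum.cong) (auto simp: join_dist_def r algebra_simps)
  moreover have "\<dots> = r * sum f E + (1 - r) * f x"
    using fin assms by (simp add: sum.distrib sum_distrib_left)
  ultimately show ?thesis using fin disj by (simp add: sum.union_disjoint)
qed

text \<open>The joined kernel is the constant \<open>r\<close> plus two uncoupled blocks: the base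
  kernel lowered by \<open>r\<close>, and \<open>1 - r\<close> times the identity on
  \<open>E\<close>.\<close>

lemma zeta_bilin_join_dist:
  "zeta_bilin (B \<union> E) (join_dist B d \<sigma>) v v
    = zeta_bilin B d v v - r * (sum v B)\<^sup>2 + r * (sum v B + sum v E)\<^sup>2 + (1 - r) * (\<Sum>x\<in>E. (v x)\<^sup>2)"
proof -
  let ?g = "\<lambda>x. \<Sum>y\<in>B \<union> E. exp (- join_dist B d \<sigma> x y) * v y"
  have "zeta_bilin (B \<union> E) (join_dist B d \<sigma>) v v = (\<Sum>x\<in>B \<union> E. v x * ?g x)"
    by (rule zeta_bilin_left_eq) simp
  also have "\<dots> = (\<Sum>x\<in>B. v x * ?g x) + (\<Sum>x\<in>E. v x * ?g x)"
    using fin disj by (rule sum.union_disjoint)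
  also have "(\<Sum>x\<in>B. v x * ?g x) = (\<Sum>x\<in>B. v x * ((\<Sum>y\<in>B. exp (- d x y) * v y) + r * sum v E))"
    by (simp add: sum_join_base)
  also have "\<dots> = zeta_bilin B d v v + r * sum v B * sum v E"
    unfolding zeta_bilin_left_eq[of B d v "\<lambda>x. \<Sum>y\<in>B. exp (- d x y) * v y" v, OF refl]
    by (simp add: distrib_left sum.distrib mult.left_commute[of _ r] flip: sum_distrib_left sum_distrib_right)
  also have "(\<Sum>x\<in>E. v x * ?g x) = (\<Sum>x\<in>E. v x * (r * sum v B + r * sum v E + (1 - r) * v x))"
    by (simp add: sum_join_extra)
  also have "\<dots> = (r * sum v B + r * sum v E) * sum v E + (1 - r) * (\<Sum>x\<in>E. (v x)\<^sup>2)"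
  proof -
    have "(\<Sum>x\<in>E. v x * (K + c * v x)) = K * sum v E + c * (\<Sum>x\<in>E. (v x)\<^sup>2)" for K c
      by (simp add: distrib_left sum.distrib sum_distrib_left power2_eq_square mult_ac)
    then show ?thesis .
  qed
  finally show ?thesis by (simp add: algebra_simps power2_eq_square)
qed

text \<open>By Cauchy-Schwarz \<open>r (sum v B)^2\<close> is at most \<open>r * sum w B\<close>
  times the base form, so the lowered base block stays positive as long as
  \<open>r * sum w B < 1\<close>.\<close>

lemma zeta_pos_join_dist:
  assumes pos: "zeta_pos B d" and sym: "\<And>x y. x \<in> B \<Longrightarrow> y \<in> B \<Longrightarrow> d x y = d y x"
    and w: "\<And>x. x \<in> B \<Longrightarrow> (\<Sum>y\<in>B. exp (- d x y) * w y) = 1"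
    and small: "r * sum w B < 1" and \<sigma>: "0 < \<sigma>"
  shows "zeta_pos (B \<union> E) (join_dist B d \<sigma>)"
  unfolding zeta_pos_def
proof (intro allI impI)
  fix v :: "'a \<Rightarrow> real" assume nz: "\<exists>x\<in>B \<union> E. v x \<noteq> 0"
  have r': "0 < r" "r < 1" using \<sigma> by (auto simp: r)
  have "zeta_bilin B d v w = sum v B" "zeta_bilin B d w w = sum w B"
    using zeta_bilin_left_eq[of B d w "\<lambda>_. 1" v] zeta_bilin_left_eq[of B d w "\<lambda>_. 1" w] w by auto
  then have CS: "(sum v B)\<^sup>2 \<le> zeta_bilin B d v v * sum w B"
    using zeta_bilin_Cauchy_Schwarz[of B d v w] pos sym by simp
  have Q0: "0 \<le> zeta_bilin B d v v" by (rule zeta_pos_nonneg[OF pos])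
  have E0: "0 \<le> (\<Sum>x\<in>E. (v x)\<^sup>2)" by (simp add: sum_nonneg)
  have base: "(1 - r * sum w B) * zeta_bilin B d v v \<le> zeta_bilin B d v v - r * (sum v B)\<^sup>2"
    using mult_left_mono[OF CS, of r] r' by (simp add: algebra_simps)
  have base0: "0 \<le> (1 - r * sum w B) * zeta_bilin B d v v" using small Q0 by simp
  have rest: "0 \<le> r * (sum v B + sum v E)\<^sup>2" "0 \<le> (1 - r) * (\<Sum>x\<in>E. (v x)\<^sup>2)" using r' E0 by auto
  show "0 < zeta_bilin (B \<union> E) (join_dist B d \<sigma>) v v"
  proof (cases "\<exists>x\<in>B. v x \<noteq> 0")
    case True
    then have "0 < (1 - r * sum w B) * zeta_bilin B d v v" using pos small by (simp add: zeta_pos_def)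
    then show ?thesis unfolding zeta_bilin_join_dist using base rest by linarith
  next
    case False
    then obtain x where "x \<in> E" "v x \<noteq> 0" using nz by auto
    then have "0 < (\<Sum>x\<in>E. (v x)\<^sup>2)" using fin by (intro sum_pos2[of E x]) auto
    then have "0 < (1 - r) * (\<Sum>x\<in>E. (v x)\<^sup>2)" using r' by simp
    then show ?thesis unfolding zeta_bilin_join_dist using base base0 rest by linarith
  qed
qed

text \<open>Without the constant \<open>r\<close> the blocks decouple and their magnitudes add up to
  \<open>m\<close>, an extra point contributing \<open>1 / (1 - r)\<close>. Restoring the constant
  turns \<open>m\<close> into \<open>m / (1 + r * m)\<close>.\<close>

lemma weighting_join_dist:
  fixes w :: "'a \<Rightarrow> real"
  assumes w: "\<And>x. x \<in> B \<Longrightarrow> (\<Sum>y\<in>B. exp (- d x y) * w y) = 1"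
    and small: "0 \<le> sum w B" "r * sum w B < 1" and \<sigma>: "0 < \<sigma>"
    and m: "m = sum w B / (1 - r * sum w B) + card E / (1 - r)"
  shows "\<exists>u. (\<forall>x\<in>B \<union> E. (\<Sum>y\<in>B \<union> E. exp (- join_dist B d \<sigma> x y) * u y) = 1) \<and> sum u (B \<union> E) = m / (1 + r * m)"
proof -
  have r': "0 < r" "r < 1" using \<sigma> by (auto simp: r)
  have m0: "0 \<le> m" using small r' by (simp add: m)
  then have "0 < 1 + r * m" using r' by (simp add: add_pos_nonneg)
  \<comment> \<open>The total weight: the constant part of the kernel contributes
    \<open>r * T\<close> to every row and leaves \<open>1 - r * T\<close> for the blocks to
    produce.\<close>
  define T where "T = m / (1 + r * m)"
  have T: "T = (1 - r * T) * m" using \<open>0 < 1 + r * m\<close> by (simp add: T_def field_simps)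
  define c where "c = (1 - r * T) / (1 - r * sum w B)"
  define u where "u x = (if x \<in> B then c * w x else (1 - r * T) / (1 - r))" for x
  have uB: "sum u B = (1 - r * T) * (sum w B / (1 - r * sum w B))"
  proof -
    have "sum u B = (\<Sum>x\<in>B. c * w x)" by (simp add: u_def)
    also have "\<dots> = c * sum w B" by (simp flip: sum_distrib_left)
    finally show ?thesis by (simp add: c_def)
  qed
  have "sum u E = (\<Sum>x\<in>E. (1 - r * T) / (1 - r))" by (rule sum.cong) (use disj in \<open>auto simp: u_def\<close>)
  then have uE: "sum u E = (1 - r * T) * (card E / (1 - r))" by simp
  have tot: "sum u B + sum u E = T"
    unfolding uB uE distrib_left[symmetric] m[symmetric] using T by simp
  have "(\<Sum>y\<in>B \<union> E. exp (- join_dist B d \<sigma> x y) * u y) = 1" if "x \<in> B \<union> E" for x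
  proof (cases "x \<in> B")
    case True
    have "(\<Sum>y\<in>B. exp (- d x y) * u y) = (\<Sum>y\<in>B. c * (exp (- d x y) * w y))"
      by (intro sum.cong) (auto simp: u_def)
    also have "\<dots> = c" using w[OF True] by (simp flip: sum_distrib_left)
    also have "\<dots> = (1 - r * T) + r * sum u B"
      unfolding uB c_def using small by (simp add: field_simps)
    finally show ?thesis
      using sum_join_base[OF True, of u] unfolding tot[symmetric] distrib_left by linarith
  next
    case False
    then have "x \<in> E" "u x = (1 - r * T) / (1 - r)" using that by (auto simp: u_def)
    then have "(1 - r) * u x = 1 - r * T" using r' by simp
    then have "(\<Sum>y\<in>B \<union> E. exp (- join_dist B d \<sigma> x y) * u y) = r * (sum u B + sum u E) + (1 - r * T)"
      using sum_join_extra[OF \<open>x \<in> E\<close>, of u] unfolding distrib_left by linarith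
    then show ?thesis using tot by simp
  qed
  moreover have "sum u (B \<union> E) = T" using sum.union_disjoint[OF fin disj, of u] tot by simp
  ultimately show ?thesis unfolding T_def by blast
qed

end

section \<open>Five points collapsing to two\<close>

text \<open>\<open>0, 3, 2, 4\<close> are the successive corners of a 4-cycle with edges of length \<open>t\<close>; the apex \<open>1\<close> is at distance
  \<open>ln 2\<close> from \<open>0, 2\<close> and \<open>ln 2 + t\<close> from \<open>3, 4\<close>.\<close>

definition apex_dist :: "real \<Rightarrow> nat \<Rightarrow> nat \<Rightarrow> real" where
  "apex_dist t i j = (if i = j then 0 else if i = 1 then ln 2 + (if 3 \<le> j then t else 0)
     else if j = 1 then ln 2 + (if 3 \<le> i then t else 0)
     else if 3 \<le> i \<longleftrightarrow> 3 \<le> j then 2 * t else t)"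

text \<open>The bound \<open>t \<le> ln 2\<close> ensures that the diagonal between 0 and 2, of
  length \<open>2 * t\<close>, is no longer than the path through the apex.\<close>

lemma Metric_space_apex_dist:
  assumes "0 < t" "t \<le> ln 2"
  shows "Metric_space I (apex_dist t)"
proof
  fix x y z
  have ln2: "0 < ln (2 :: real)" by simp
  show "0 \<le> apex_dist t x y" using assms ln2 by (simp add: apex_dist_def)
  show "apex_dist t x y = apex_dist t y x" by (auto simp: apex_dist_def)
  show "(apex_dist t x y = 0) = (x = y)" using assms ln2 by (simp add: apex_dist_def)
  show "apex_dist t x z \<le> apex_dist t x y + apex_dist t y z"
    using assms ln2 by (simp add: apex_dist_def)
qed

lemma exp_minus_apex_dist:
  assumes "q = exp (- t)"
  shows "exp (- apex_dist t i j) = (if i = j then 1 else if i = 1 then (if 3 \<le> j then q / 2 else 1 / 2)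
     else if j = 1 then (if 3 \<le> i then q / 2 else 1 / 2)
     else if 3 \<le> i \<longleftrightarrow> 3 \<le> j then q\<^sup>2 else q)"
proof -
  have "exp (- ln 2 - t) = q / 2" by (simp add: assms exp_diff exp_minus field_simps)
  moreover have "exp (- (2 * t)) = q\<^sup>2" unfolding assms by (rule exp_minus_numeral_mult)
  moreover have "exp (- ln (2 :: real)) = 1 / 2" by (simp add: exp_minus)
  ultimately show ?thesis by (simp add: apex_dist_def flip: assms)
qed

text \<open>Squares are split off for the differences of opposite corners, then for the apex. A
  binary form in the sums \<open>\<sigma>\<close>, \<open>\<tau>\<close> remains, of determinant
  \<open>A B = (1 - q^2)^2 / 8\<close>.\<close>

lemma zeta_pos_apex_dist:
  assumes "t > 0"
  shows "zeta_pos {..<5} (apex_dist t)"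
  unfolding zeta_pos_def
proof (intro allI impI)
  fix v :: "nat \<Rightarrow> real" assume nz: "\<exists>x\<in>{..<5}. v x \<noteq> 0"
  define q where "q = exp (- t)"
  have q: "0 < q" "q < 1" using assms by (auto simp: q_def)
  define a c b d y where v: "a = v 0" "c = v 2" "b = v 3" "d = v 4" "y = v 1"
  define A where "A = (1 + 2 * q\<^sup>2) / 4"
  define B where "B = (1 - q\<^sup>2)\<^sup>2 / (2 * (1 + 2 * q\<^sup>2))"
  have den: "0 < 1 + 2 * q\<^sup>2" using q by (simp add: add_pos_pos)
  have A: "A > 0" using den by (simp add: A_def)
  have c0: "0 < 1 - q\<^sup>2" using q by (simp add: power_less_one_iff)
  then have B: "B > 0" using den by (simp add: B_def)
  define \<sigma> \<tau> where "\<sigma> = a + c" and "\<tau> = b + d"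
  have "zeta_bilin {..<5} (apex_dist t) v v = (a\<^sup>2 + c\<^sup>2) + 2 * q\<^sup>2 * (a * c) + (b\<^sup>2 + d\<^sup>2) + 2 * q\<^sup>2 * (b * d)
      + 2 * q * (\<sigma> * \<tau>) + y * \<sigma> + q * (y * \<tau>) + y\<^sup>2"
    unfolding zeta_bilin_def lessThan_5 exp_minus_apex_dist[OF q_def] v \<sigma>_def \<tau>_def
    by (simp add: algebra_simps power2_eq_square)
  also have "\<dots> = (1 - q\<^sup>2) / 2 * ((a - c)\<^sup>2 + (b - d)\<^sup>2) + (y + (\<sigma> + q * \<tau>) / 2)\<^sup>2
      + (A * \<sigma>\<^sup>2 + (2 + q\<^sup>2) / 4 * \<tau>\<^sup>2 + 3 * q / 2 * (\<sigma> * \<tau>))"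
    by (simp add: A_def \<sigma>_def \<tau>_def field_simps power2_eq_square)
  also have "A * \<sigma>\<^sup>2 + (2 + q\<^sup>2) / 4 * \<tau>\<^sup>2 + 3 * q / 2 * (\<sigma> * \<tau>) = (A * \<sigma> + 3 * q / 4 * \<tau>)\<^sup>2 / A + B * \<tau>\<^sup>2"
  proof -
    have *: "(3 * q / 4)\<^sup>2 / (D / 4) + z / (2 * D) = ((9 * q\<^sup>2 + 2 * z) / 4) / D" if "D > 0" for z D :: real
      using that by (simp add: field_simps power2_eq_square)
    have "(3 * q / 4)\<^sup>2 / A + B = ((9 * q\<^sup>2 + 2 * (1 - q\<^sup>2)\<^sup>2) / 4) / (1 + 2 * q\<^sup>2)"
      unfolding A_def B_def by (rule *[OF den])
    also have "(9 * q\<^sup>2 + 2 * (1 - q\<^sup>2)\<^sup>2) / 4 = (2 + q\<^sup>2) / 4 * (1 + 2 * q\<^sup>2)"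
      by (simp add: algebra_simps power2_eq_square)
    also have "(2 + q\<^sup>2) / 4 * (1 + 2 * q\<^sup>2) / (1 + 2 * q\<^sup>2) = (2 + q\<^sup>2) / 4"
      by (rule nonzero_mult_div_cancel_right) (use den in simp)
    finally have e: "(2 + q\<^sup>2) / 4 = (3 * q / 4)\<^sup>2 / A + B" by (rule sym)
    show ?thesis unfolding e using A by (simp add: field_simps power2_eq_square)
  qed
  finally have Q: "zeta_bilin {..<5} (apex_dist t) v v =
    (1 - q\<^sup>2) / 2 * ((a - c)\<^sup>2 + (b - d)\<^sup>2) + (y + (\<sigma> + q * \<tau>) / 2)\<^sup>2
      + ((A * \<sigma> + 3 * q / 4 * \<tau>)\<^sup>2 / A + B * \<tau>\<^sup>2)" .
  have nonneg: "0 \<le> (1 - q\<^sup>2) / 2 * ((a - c)\<^sup>2 + (b - d)\<^sup>2)" "0 \<le> (y + (\<sigma> + q * \<tau>) / 2)\<^sup>2"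
    "0 \<le> (A * \<sigma> + 3 * q / 4 * \<tau>)\<^sup>2 / A" "0 \<le> B * \<tau>\<^sup>2"
    using c0 A B by simp_all
  show "0 < zeta_bilin {..<5} (apex_dist t) v v"
  proof (rule ccontr)
    assume "\<not> ?thesis"
    then have zero: "(1 - q\<^sup>2) / 2 * ((a - c)\<^sup>2 + (b - d)\<^sup>2) = 0" "(y + (\<sigma> + q * \<tau>) / 2)\<^sup>2 = 0"
      "(A * \<sigma> + 3 * q / 4 * \<tau>)\<^sup>2 / A = 0" "B * \<tau>\<^sup>2 = 0"
      unfolding Q using nonneg by linarith+
    have "a = c" "b = d" using zero(1) c0 by (simp_all add: sum_power2_eq_zero_iff)
    moreover have "\<tau> = 0" using zero(4) B by simp
    moreover have "\<sigma> = 0" using zero(3) A \<open>\<tau> = 0\<close> by simp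
    moreover have "y = 0" using zero(2) \<open>\<tau> = 0\<close> \<open>\<sigma> = 0\<close> by simp
    ultimately have "a = 0" "b = 0" "c = 0" "d = 0" "y = 0" by (auto simp: \<sigma>_def \<tau>_def)
    then show False using nz unfolding lessThan_5 v by auto
  qed
qed

lemma weighting_apex_dist:
  assumes "t > 0"
  shows "\<exists>w. (\<forall>x\<in>{..<5}. (\<Sum>y\<in>{..<5}. exp (- apex_dist t x y) * w y) = 1) \<and>
    3 / 2 \<le> sum w {..<5} \<and> sum w {..<5} < 4"
proof -
  define q where "q = exp (- t)"
  have q: "0 < q" "q < 1" using assms by (auto simp: q_def)
  \<comment> \<open>By symmetry the weights are \<open>\<alpha>\<close> on 0, 2, then
    \<open>\<beta>\<close> on 3, 4 and \<open>\<gamma>\<close> on the apex. Eliminating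
    \<open>\<gamma>\<close> leaves \<open>eq1\<close> and \<open>eq2\<close>, of determinant
    \<open>2 (1 - q^2)^2\<close>; cancelling \<open>2 (1 - q)\<close> in Cramer's rule leaves
    \<open>\<Delta>\<close>.\<close>
  define \<Delta> where "\<Delta> = (1 - q) * (1 + q)\<^sup>2"
  have \<Delta>: "\<Delta> > 0" using q by (simp add: \<Delta>_def)
  define \<alpha> where "\<alpha> = (1 - 2 * q) / \<Delta>"
  define \<beta> where "\<beta> = (1 - q + q\<^sup>2) / \<Delta>"
  define \<gamma> where "\<gamma> = 1 - \<alpha> - q * \<beta>"
  have eq1: "(1 + 2 * q\<^sup>2) * \<alpha> + 3 * q * \<beta> = 1"
  proof -
    have "(1 + 2 * q\<^sup>2) * (1 - 2 * q) + 3 * q * (1 - q + q\<^sup>2) = \<Delta>"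
      unfolding \<Delta>_def by (simp add: algebra_simps power2_eq_square)
    then show ?thesis using \<Delta> by (simp add: \<alpha>_def \<beta>_def flip: add_divide_distrib)
  qed
  have eq2: "3 * q * \<alpha> + (2 + q\<^sup>2) * \<beta> = 2 - q"
  proof -
    have "3 * q * (1 - 2 * q) + (2 + q\<^sup>2) * (1 - q + q\<^sup>2) = (2 - q) * \<Delta>"
      unfolding \<Delta>_def by (simp add: algebra_simps power2_eq_square)
    then show ?thesis using \<Delta> by (simp add: \<alpha>_def \<beta>_def flip: add_divide_distrib)
  qed
  define w where "w i = (if i = (1 :: nat) then \<gamma> else if i < 3 then \<alpha> else \<beta>)" for i
  have e0: "(1 + q\<^sup>2) * \<alpha> + 2 * q * \<beta> + \<gamma> / 2 = 1" using eq1 by (simp add: \<gamma>_def field_simps)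
  have e3: "2 * q * \<alpha> + (1 + q\<^sup>2) * \<beta> + q * \<gamma> / 2 = 1"
    using eq2 by (simp add: \<gamma>_def field_simps power2_eq_square)
  have e1: "\<alpha> + q * \<beta> + \<gamma> = 1" by (simp add: \<gamma>_def)
  have "(\<Sum>y\<in>{..<5}. exp (- apex_dist t x y) * w y) = 1" if "x \<in> {..<5}" for x
    using that e0 e1 e3 unfolding lessThan_5 exp_minus_apex_dist[OF q_def] w_def
    by (auto simp: algebra_simps)
  moreover have S: "sum w {..<5} = 1 + (3 - 5 * q + 3 * q\<^sup>2 - q ^ 3) / \<Delta>"
  proof -
    have "sum w {..<5} = 1 + \<alpha> + (2 - q) * \<beta>" unfolding lessThan_5 w_def by (simp add: \<gamma>_def algebra_simps)
    also have "\<dots> = 1 + ((1 - 2 * q) + (2 - q) * (1 - q + q\<^sup>2)) / \<Delta>"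
      unfolding \<alpha>_def \<beta>_def times_divide_eq_right add.assoc add_divide_distrib[symmetric] ..
    also have "(1 - 2 * q) + (2 - q) * (1 - q + q\<^sup>2) = 3 - 5 * q + 3 * q\<^sup>2 - q ^ 3"
      by (simp add: algebra_simps power2_eq_square power3_eq_cube)
    finally show ?thesis .
  qed
  \<comment> \<open>The total weight tends to \<open>3 / 2\<close> as \<open>q\<close> tends to 1,
    so this bound is sharp.\<close>
  moreover have "1 / 2 \<le> (3 - 5 * q + 3 * q\<^sup>2 - q ^ 3) / \<Delta>"
  proof -
    have "0 \<le> (1 - q)\<^sup>2 * (5 - q)" using q by simp
    also have "\<dots> = 2 * (3 - 5 * q + 3 * q\<^sup>2 - q ^ 3) - \<Delta>"
      unfolding \<Delta>_def by (simp add: algebra_simps power2_eq_square power3_eq_cube)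
    finally show ?thesis using \<Delta> by (simp add: pos_le_divide_eq)
  qed
  \<comment> \<open>A total below 4 is the condition for joining further points with
    \<open>r = 1 / 4\<close>.\<close>
  moreover have "(3 - 5 * q + 3 * q\<^sup>2 - q ^ 3) / \<Delta> < 3"
  proof -
    have "0 < q * (1 - q) * (8 + 2 * q)" using q by simp
    also have "\<dots> = 3 * \<Delta> - (3 - 5 * q + 3 * q\<^sup>2 - q ^ 3)"
      unfolding \<Delta>_def by (simp add: algebra_simps power2_eq_square power3_eq_cube)
    finally show ?thesis using \<Delta> by (simp add: pos_divide_less_eq)
  qed
  ultimately show ?thesis by (intro exI[of _ w]) auto
qed

section \<open>Counterexamples near one point and near several points\<close>

lemma magnitude_discontinuous_near_point:
  "\<exists>(X :: 'a::infinite metric) (Y :: nat \<Rightarrow> 'b::infinite metric).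
    finite_posdef_space X \<and> card (mspace X) = 1 \<and>
    (\<forall>n. finite_posdef_space (Y n) \<and> card (mspace (Y n)) = 5) \<and>
    (\<lambda>n. GH_dist (Y n) X) \<longlonglongrightarrow> 0 \<and> \<not> (\<lambda>n. magnitude (Y n)) \<longlonglongrightarrow> magnitude X"
proof -
  \<comment> \<open>All distances are at most \<open>6 * t n\<close>, so the five points collapse
    onto the point 0, whose magnitude 1 is below \<open>7 / 6\<close>.\<close>
  define t where "t n = inverse (real (Suc n))" for n
  have t: "0 < t n" for n by (simp add: t_def)
  have "\<forall>n. \<exists>w. (\<forall>x\<in>{..<5}. (\<Sum>y\<in>{..<5}. exp (- two_cluster_dist (t n) x y) * w y) = 1) \<and> 7 / 6 \<le> sum w {..<5}"
    using weighting_two_cluster_dist[OF t] by blast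
  from choice[OF this] obtain w where
    w: "\<And>n x. x \<in> {..<5} \<Longrightarrow> (\<Sum>y\<in>{..<5}. exp (- two_cluster_dist (t n) x y) * w n y) = 1"
      "\<And>n. 7 / 6 \<le> sum (w n) {..<5}" by blast
  have "\<exists>(X :: 'a metric) (Y :: nat \<Rightarrow> 'b metric).
    finite_posdef_space X \<and> card (mspace X) = card {0 :: nat} \<and>
    (\<forall>n. finite_posdef_space (Y n) \<and> card (mspace (Y n)) = card {..<5 :: nat}) \<and>
    (\<lambda>n. GH_dist (Y n) X) \<longlonglongrightarrow> 0 \<and> \<not> (\<lambda>n. magnitude (Y n)) \<longlonglongrightarrow> magnitude X"
  proof (rule discontinuity_from_kernels[where D = "\<lambda>n. two_cluster_dist (t n)" and w = w
        and wA = "\<lambda>_. 1" and \<rho> = "\<lambda>n. 6 * t n" and c = "7 / 6"])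
    show "Metric_space {..<5} (two_cluster_dist (t n))" for n by (rule Metric_space_two_cluster_dist[OF t])
    show "zeta_pos {..<5} (two_cluster_dist (t n))" for n by (rule zeta_pos_two_cluster_dist[OF t])
    show "two_cluster_dist (t n) x y = two_cluster_dist (t 0) x y" if "x \<in> {0}" "y \<in> {0}" for n x y
      using that by (simp add: two_cluster_dist_def)
    show "\<exists>a\<in>{0}. two_cluster_dist (t n) x a \<le> 6 * t n" for n x
      using t[of n] by (simp add: two_cluster_dist_def)
    show "(\<lambda>n. 6 * t n) \<longlonglongrightarrow> 0"
      unfolding t_def by (intro tendsto_mult_right_zero LIMSEQ_inverse_real_of_nat)
    show "(\<Sum>y\<in>{..<5}. exp (- two_cluster_dist (t n) x y) * w n y) = 1" if "x \<in> {..<5}" for n x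
      by (rule w(1)[OF that])
    show "7 / 6 \<le> sum (w n) {..<5}" for n by (rule w(2))
    show "(\<Sum>y\<in>{0}. exp (- two_cluster_dist (t 0) x y) * 1) = 1" if "x \<in> {0}" for x
      using that by (simp add: two_cluster_dist_def)
  qed simp_all
  then show ?thesis by simp
qed

text \<open>The apex family is joined with \<open>N - 2\<close> points at distance
  \<open>ln 4\<close>. The joined magnitude is a strictly increasing function \<open>J\<close> of
  the base magnitude, so the gap between \<open>4 / 3\<close> and \<open>3 / 2\<close>
  persists.\<close>

lemma magnitude_discontinuous_near_many_points:
  assumes "N \<ge> 2"
  shows "\<exists>(X :: 'a::infinite metric) (Y :: nat \<Rightarrow> 'b::infinite metric).
    finite_posdef_space X \<and> card (mspace X) = N \<and>
    (\<forall>n. finite_posdef_space (Y n) \<and> card (mspace (Y n)) = N + 3) \<and>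
    (\<lambda>n. GH_dist (Y n) X) \<longlonglongrightarrow> 0 \<and> \<not> (\<lambda>n. magnitude (Y n)) \<longlonglongrightarrow> magnitude X"
proof -
  define t where "t n = ln 2 * inverse (real (Suc n))" for n
  have t: "0 < t n" "t n \<le> ln 2" for n by (auto simp: t_def field_simps)
  define B where "B = {..<5 :: nat}"
  define E where "E = {5..<N + 3}"
  have BE: "finite B" "finite E" "B \<inter> E = {}" by (auto simp: B_def E_def)
  \<comment> \<open>This gives \<open>r = 1 / 4\<close>, hence \<open>r M < 1\<close> for base
    magnitudes \<open>M < 4\<close>.\<close>
  define \<sigma> where "\<sigma> = ln (4 :: real)"
  have \<sigma>: "0 < \<sigma>" "1 / 4 = exp (- \<sigma>)" by (simp_all add: \<sigma>_def exp_minus)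
  have ln4: "\<sigma> = 2 * ln 2" using ln_realpow[of 2 2] by (simp add: \<sigma>_def)
  define D where "D n = join_dist B (apex_dist (t n)) \<sigma>" for n
  define m where "m M = M / (1 - 1 / 4 * M) + card E / (1 - 1 / 4)" for M :: real
  define J where "J M = m M / (1 + 1 / 4 * m M)" for M :: real
  have m: "0 \<le> m M" if "0 \<le> M" "M < 4" for M using that by (simp add: m_def)
  have m_less: "m M < m M'" if "0 \<le> M" "M < M'" "M' < 4" for M M'
    using that by (simp add: m_def field_simps)
  have J_less: "J M < J M'" if "0 \<le> M" "M < M'" "M' < 4" for M M'
  proof -
    have "0 < 1 + 1 / 4 * m M" "0 < 1 + 1 / 4 * m M'" using m[of M] m[of M'] that by auto
    then show ?thesis using m_less[OF that] by (simp add: J_def field_simps)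
  qed
  have diag: "apex_dist s x x = 0" for s x by (simp add: apex_dist_def)
  have "\<exists>u. (\<forall>x\<in>B \<union> E. (\<Sum>y\<in>B \<union> E. exp (- D n x y) * u y) = 1) \<and> J (3 / 2) \<le> sum u (B \<union> E) \<and>
      zeta_pos (B \<union> E) (D n)" for n
  proof -
    obtain w where w: "\<And>x. x \<in> B \<Longrightarrow> (\<Sum>y\<in>B. exp (- apex_dist (t n) x y) * w y) = 1"
      "3 / 2 \<le> sum w B" "sum w B < 4"
      using weighting_apex_dist[OF t(1)[of n]] unfolding B_def by auto
    have "J (3 / 2) \<le> J (sum w B)"
    proof (cases "sum w B = 3 / 2")
      case True
      then show ?thesis by (simp only: order_refl)
    next
      case False
      then show ?thesis using J_less[of "3 / 2" "sum w B"] w(2,3) by simp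
    qed
    moreover have "\<exists>u. (\<forall>x\<in>B \<union> E. (\<Sum>y\<in>B \<union> E. exp (- D n x y) * u y) = 1) \<and> sum u (B \<union> E) = J (sum w B)"
      unfolding D_def J_def
      by (rule weighting_join_dist[OF BE diag \<sigma>(2) w(1)]) (use w \<sigma> in \<open>auto simp: m_def\<close>)
    moreover have "zeta_pos (B \<union> E) (D n)"
      unfolding D_def
    proof (rule zeta_pos_join_dist[OF BE diag \<sigma>(2) _ _ w(1)])
      show "zeta_pos B (apex_dist (t n))" unfolding B_def by (rule zeta_pos_apex_dist[OF t(1)])
      show "apex_dist (t n) x y = apex_dist (t n) y x" for x y by (auto simp: apex_dist_def)
    qed (use w \<sigma> in auto)
    ultimately show ?thesis by auto
  qed
  then have "\<forall>n. \<exists>u. (\<forall>x\<in>B \<union> E. (\<Sum>y\<in>B \<union> E. exp (- D n x y) * u y) = 1) \<and> J (3 / 2) \<le> sum u (B \<union> E) \<and>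
      zeta_pos (B \<union> E) (D n)" by blast
  from choice[OF this] obtain u where
    u: "\<And>n x. x \<in> B \<union> E \<Longrightarrow> (\<Sum>y\<in>B \<union> E. exp (- D n x y) * u n y) = 1"
      "\<And>n. J (3 / 2) \<le> sum (u n) (B \<union> E)" "\<And>n. zeta_pos (B \<union> E) (D n)" by blast
  define A where "A = {0, 1 :: nat}"
  have AE: "finite A" "A \<inter> E = {}" by (auto simp: A_def E_def)
  have AB: "A \<subseteq> B" by (auto simp: A_def B_def)
  \<comment> \<open>Distinct limit points have distance \<open>ln 2\<close> or \<open>ln 4\<close>,
    whatever \<open>n\<close> is.\<close>
  have DA: "D n x y = join_dist A (apex_dist (t 0)) \<sigma> x y" if "x \<in> A \<union> E" "y \<in> A \<union> E" for n x y
  proof -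
    have "x \<in> B \<longleftrightarrow> x \<in> A" "y \<in> B \<longleftrightarrow> y \<in> A" using that AB BE by auto
    then show ?thesis by (auto simp: D_def join_dist_def apex_dist_def A_def)
  qed
  \<comment> \<open>Since \<open>exp (- ln 2) = 1 / 2\<close>, the base pair has weights
    \<open>2 / 3\<close> and magnitude \<open>4 / 3\<close>.\<close>
  have "\<exists>v. (\<forall>x\<in>A \<union> E. (\<Sum>y\<in>A \<union> E. exp (- join_dist A (apex_dist (t 0)) \<sigma> x y) * v y) = 1) \<and>
      sum v (A \<union> E) = m (4 / 3) / (1 + 1 / 4 * m (4 / 3))"
  proof (rule weighting_join_dist[OF AE(1) BE(2) AE(2) diag \<sigma>(2), where w = "\<lambda>_. 2 / 3"])
    show "(\<Sum>y\<in>A. exp (- apex_dist (t 0) x y) * (2 / 3)) = 1" if "x \<in> A" for x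
      using that by (auto simp: A_def apex_dist_def exp_minus)
  qed (use \<sigma> in \<open>auto simp: A_def m_def\<close>)
  then obtain v where v: "\<And>x. x \<in> A \<union> E \<Longrightarrow> (\<Sum>y\<in>A \<union> E. exp (- join_dist A (apex_dist (t 0)) \<sigma> x y) * v y) = 1"
    "sum v (A \<union> E) = J (4 / 3)" unfolding J_def by blast
  have "\<exists>(X :: 'a metric) (Y :: nat \<Rightarrow> 'b metric).
    finite_posdef_space X \<and> card (mspace X) = card (A \<union> E) \<and>
    (\<forall>n. finite_posdef_space (Y n) \<and> card (mspace (Y n)) = card (B \<union> E)) \<and>
    (\<lambda>n. GH_dist (Y n) X) \<longlonglongrightarrow> 0 \<and> \<not> (\<lambda>n. magnitude (Y n)) \<longlonglongrightarrow> magnitude X"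
  proof (rule discontinuity_from_kernels[where D = D and w = u
        and wA = v and \<rho> = "\<lambda>n. 2 * t n" and c = "J (3 / 2)"])
    show "finite (B \<union> E)" "A \<union> E \<subseteq> B \<union> E" using BE AB by auto
    show "Metric_space (B \<union> E) (D n)" for n
      unfolding D_def
    proof (rule Metric_space_join_dist[OF Metric_space_apex_dist[OF t] \<sigma>(1)])
      show "apex_dist (t n) x y \<le> 2 * \<sigma>" for x y
        using t[of n] by (simp add: apex_dist_def ln4)
    qed
    show "zeta_pos (B \<union> E) (D n)" for n by (rule u(3))
    show "D n x y = D 0 x y" if "x \<in> A \<union> E" "y \<in> A \<union> E" for n x y
      using DA[OF that, of n] DA[OF that, of 0] by simp
    show "\<exists>a\<in>A \<union> E. D n x a \<le> 2 * t n" if "x \<in> B \<union> E" for n x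
    proof (cases "x \<in> A \<union> E")
      case True
      then show ?thesis using t(1)[of n] by (intro bexI[of _ x]) (auto simp: D_def join_dist_def)
    next
      case False
      then have "x \<in> B" "x \<noteq> 0" "x \<noteq> 1" using that by (auto simp: A_def)
      \<comment> \<open>The point \<open>x\<close> is 2, 3 or 4, a corner of the 4-cycle containing
        0.\<close>
      then have "D n x 0 \<le> 2 * t n" using t(1)[of n] by (simp add: D_def join_dist_def apex_dist_def B_def)
      then show ?thesis by (intro bexI[of _ 0]) (auto simp: A_def)
    qed
    show "(\<lambda>n. 2 * t n) \<longlonglongrightarrow> 0"
      unfolding t_def by (intro tendsto_mult_right_zero LIMSEQ_inverse_real_of_nat)
    show "(\<Sum>y\<in>B \<union> E. exp (- D n x y) * u n y) = 1" if "x \<in> B \<union> E" for n x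
      by (rule u(1)[OF that])
    show "(\<Sum>y\<in>A \<union> E. exp (- D 0 x y) * v y) = 1" if "x \<in> A \<union> E" for x
      using v(1)[OF that] DA[OF that, of _ 0] by simp
    show "J (3 / 2) \<le> sum (u n) (B \<union> E)" for n by (rule u(2))
    show "sum v (A \<union> E) < J (3 / 2)" unfolding v(2) by (rule J_less) auto
  qed
  moreover have "card (A \<union> E) = N" "card (B \<union> E) = N + 3"
    using AE BE assms by (auto simp: card_Un_disjoint A_def B_def E_def)
  ultimately show ?thesis by simp
qed

section \<open>Continuity\<close>

text \<open>The hypothesis \<open>upper\<close> is the common form of the two upper bounds. The
  lower bound from transplanting the weighting of \<open>X\<close> completes a sandwich.\<close>

lemma magnitude_tendsto:
  fixes X :: "'a metric" and Y :: "nat \<Rightarrow> 'b metric"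
  assumes X: "finite_posdef_space X" "mspace X \<noteq> {}" and Y: "\<And>n. finite_posdef_space (Y n)"
    and lim: "(\<lambda>n. GH_dist (Y n) X) \<longlonglongrightarrow> 0"
    and upper: "0 < e0" "\<And>n p e. p ` mspace (Y n) = mspace X \<Longrightarrow> distortion_le (Y n) X p e \<Longrightarrow> 0 < e \<Longrightarrow> e \<le> e0
      \<Longrightarrow> (1 - K * e) * magnitude (Y n) \<le> magnitude X"
  shows "(\<lambda>n. magnitude (Y n)) \<longlonglongrightarrow> magnitude X"
proof (rule LIMSEQ_I)
  let ?M = "magnitude X"
  have M: "?M > 0" by (rule magnitude_pos[OF X])
  obtain C where C: "\<forall>(Z :: 'b metric) p e. finite_posdef_space Z \<and> p ` mspace Z = mspace X \<and> distortion_le Z X p e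
      \<longrightarrow> ?M\<^sup>2 \<le> magnitude Z * (?M + C * e)"
    using magnitude_lower_near[OF X(1)] by metis
  obtain S where S: "S > 0" "\<forall>x\<in>mspace X. \<forall>x'\<in>mspace X. x \<noteq> x' \<longrightarrow> S \<le> mdist X x x'"
    using separated_finite_mspace X(1) unfolding finite_posdef_space_def by metis
  fix \<delta> :: real assume \<delta>: "0 < \<delta>"
  have id: "((\<lambda>e. e) \<longlongrightarrow> 0) (at_right (0 :: real))" by (rule tendsto_ident_at)
  \<comment> \<open>Both bounds tend to the magnitude of \<open>X\<close> as \<open>e\<close>
    decreases to 0, so a single \<open>e\<close> brings both within \<open>\<delta>\<close>.\<close>
  have l1: "((\<lambda>e. ?M\<^sup>2 / (?M + C * e)) \<longlongrightarrow> ?M\<^sup>2 / (?M + C * 0)) (at_right 0)"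
    and l2: "((\<lambda>e. ?M / (1 - K * e)) \<longlongrightarrow> ?M / (1 - K * 0)) (at_right 0)"
    and l3: "((\<lambda>e. ?M + C * e) \<longlongrightarrow> ?M + C * 0) (at_right 0)"
    and l4: "((\<lambda>e. 1 - K * e) \<longlongrightarrow> 1 - K * 0) (at_right 0)"
    by ((intro tendsto_intros; use M in simp))+
  have "\<forall>\<^sub>F e in at_right 0. ?M - \<delta> < ?M\<^sup>2 / (?M + C * e)"
    by (rule order_tendstoD(1)[OF l1]) (use M \<delta> in \<open>simp add: power2_eq_square\<close>)
  moreover have "\<forall>\<^sub>F e in at_right 0. ?M / (1 - K * e) < ?M + \<delta>"
    by (rule order_tendstoD(2)[OF l2]) (use \<delta> in simp)
  moreover have "\<forall>\<^sub>F e in at_right 0. 0 < ?M + C * e"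
    by (rule order_tendstoD(1)[OF l3]) (use M in simp)
  moreover have "\<forall>\<^sub>F e in at_right 0. 0 < 1 - K * e"
    by (rule order_tendstoD(1)[OF l4]) simp
  moreover have "\<forall>\<^sub>F e in at_right 0. e < min e0 S"
    by (rule order_tendstoD(2)[OF id]) (use upper S in simp)
  moreover have "\<forall>\<^sub>F e in at_right (0 :: real). 0 < e" by (rule eventually_at_right_less)
  ultimately have "\<forall>\<^sub>F e in at_right 0. ?M - \<delta> < ?M\<^sup>2 / (?M + C * e) \<and> ?M / (1 - K * e) < ?M + \<delta> \<and>
      0 < ?M + C * e \<and> 0 < 1 - K * e \<and> e < min e0 S \<and> 0 < e"
    by eventually_elim simp
  then obtain e where e: "?M - \<delta> < ?M\<^sup>2 / (?M + C * e)" "?M / (1 - K * e) < ?M + \<delta>"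
      "0 < ?M + C * e" "0 < 1 - K * e" "e < e0" "e < S" "0 < e"
    using eventually_happens'[OF trivial_limit_at_right_real] by (metis (lifting) min_less_iff_conj)
  \<comment> \<open>Halving \<open>e\<close> compensates the factor 2 in passing from distance to
    distortion.\<close>
  have "\<forall>\<^sub>F n in sequentially. GH_dist (Y n) X < ennreal (e / 2)"
    by (rule order_tendstoD(2)[OF lim]) (use e in simp)
  then obtain n0 where n0: "\<And>n. n \<ge> n0 \<Longrightarrow> GH_dist (Y n) X < ennreal (e / 2)"
    by (auto simp: eventually_sequentially)
  have "norm (magnitude (Y n) - ?M) < \<delta>" if n: "n \<ge> n0" for n
  proof -
    obtain p where p: "p ` mspace (Y n) = mspace X" "distortion_le (Y n) X p e"
      using GH_dist_less_imp_surjection[OF n0[OF n]] S(2) e(6) by fastforce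
    have "(1 - K * e) * magnitude (Y n) \<le> ?M" using upper(2)[OF p] e by simp
    then have "magnitude (Y n) \<le> ?M / (1 - K * e)" using e(4) by (simp add: pos_le_divide_eq mult.commute)
    moreover have "?M\<^sup>2 / (?M + C * e) \<le> magnitude (Y n)"
      using C Y p e(3) by (simp add: pos_divide_le_eq)
    ultimately show ?thesis using e(1,2) by (simp add: abs_less_iff)
  qed
  then show "\<exists>n0. \<forall>n\<ge>n0. norm (magnitude (Y n) - ?M) < \<delta>" by blast
qed

lemma magnitude_singleton:
  assumes "finite_posdef_space X" "mspace X = {x}"
  shows "magnitude X = 1"
proof -
  have "magnitude X = sum (\<lambda>_. 1) (mspace X)"
    by (rule magnitude_eq_sum_weighting[OF assms(1)]) (use assms(2) in \<open>simp add: mdist_self\<close>)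
  then show ?thesis using assms(2) by simp
qed

section \<open>Continuity of magnitude under a bound on the number of points\<close>

theorem corollary1p2:
  fixes N k :: nat
  assumes "N \<ge> 1" and "k \<ge> 1"
  shows "(\<forall>(X :: 'a::infinite metric) (Y :: nat \<Rightarrow> 'b::infinite metric).
            finite_posdef_space X \<and> card (mspace X) = N \<and>
            (\<forall>n. finite_posdef_space (Y n) \<and> card (mspace (Y n)) \<le> k) \<and>
            (\<lambda>n. GH_dist (Y n) X) \<longlonglongrightarrow> 0
            \<longrightarrow> (\<lambda>n. magnitude (Y n)) \<longlonglongrightarrow> magnitude X)
         \<longleftrightarrow> k \<le> N + 2 \<or> (N = 1 \<and> k = 4)"
proof
  assume cont: "\<forall>(X :: 'a metric) (Y :: nat \<Rightarrow> 'b metric).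
            finite_posdef_space X \<and> card (mspace X) = N \<and>
            (\<forall>n. finite_posdef_space (Y n) \<and> card (mspace (Y n)) \<le> k) \<and>
            (\<lambda>n. GH_dist (Y n) X) \<longlonglongrightarrow> 0
            \<longrightarrow> (\<lambda>n. magnitude (Y n)) \<longlonglongrightarrow> magnitude X"
  show "k \<le> N + 2 \<or> (N = 1 \<and> k = 4)"
  proof (rule ccontr)
    assume neg: "\<not> (k \<le> N + 2 \<or> (N = 1 \<and> k = 4))"
    \<comment> \<open>The number \<open>c\<close> is 5 for \<open>N = 1\<close> and
      \<open>N + 3\<close> otherwise; for \<open>N = 1\<close> the negated condition excludes
      \<open>k = 4\<close> as well, so \<open>c \<le> k\<close>.\<close>
    obtain c where c: "c \<le> k" and "\<exists>(X :: 'a metric) (Y :: nat \<Rightarrow> 'b metric).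
      finite_posdef_space X \<and> card (mspace X) = N \<and>
      (\<forall>n. finite_posdef_space (Y n) \<and> card (mspace (Y n)) = c) \<and>
      (\<lambda>n. GH_dist (Y n) X) \<longlonglongrightarrow> 0 \<and> \<not> (\<lambda>n. magnitude (Y n)) \<longlonglongrightarrow> magnitude X"
    proof (cases "N = 1")
      case True
      then show ?thesis using that[of 5] neg magnitude_discontinuous_near_point by simp
    next
      case False
      then have "N \<ge> 2" using assms by simp
      from that[OF _ magnitude_discontinuous_near_many_points[OF this]] neg show ?thesis by simp
    qed
    then obtain X :: "'a metric" and Y :: "nat \<Rightarrow> 'b metric" where
      XY: "finite_posdef_space X" "card (mspace X) = N" "\<forall>n. finite_posdef_space (Y n) \<and> card (mspace (Y n)) = c"
      "(\<lambda>n. GH_dist (Y n) X) \<longlonglongrightarrow> 0" "\<not> (\<lambda>n. magnitude (Y n)) \<longlonglongrightarrow> magnitude X"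
      by (elim exE conjE)
    have "\<forall>n. finite_posdef_space (Y n) \<and> card (mspace (Y n)) \<le> k" using XY(3) c by simp
    with cont XY(1,2,4) have "(\<lambda>n. magnitude (Y n)) \<longlonglongrightarrow> magnitude X" by simp
    with XY(5) show False by simp
  qed
next
  assume small: "k \<le> N + 2 \<or> (N = 1 \<and> k = 4)"
  show "\<forall>(X :: 'a metric) (Y :: nat \<Rightarrow> 'b metric).
            finite_posdef_space X \<and> card (mspace X) = N \<and>
            (\<forall>n. finite_posdef_space (Y n) \<and> card (mspace (Y n)) \<le> k) \<and>
            (\<lambda>n. GH_dist (Y n) X) \<longlonglongrightarrow> 0
            \<longrightarrow> (\<lambda>n. magnitude (Y n)) \<longlonglongrightarrow> magnitude X"
  proof (intro allI impI, elim conjE)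
    fix X :: "'a metric" and Y :: "nat \<Rightarrow> 'b metric"
    assume X: "finite_posdef_space X" "card (mspace X) = N"
      and Y: "\<forall>n. finite_posdef_space (Y n) \<and> card (mspace (Y n)) \<le> k"
      and lim: "(\<lambda>n. GH_dist (Y n) X) \<longlonglongrightarrow> 0"
    have Y1: "finite_posdef_space (Y n)" and Y2: "card (mspace (Y n)) \<le> k" for n using Y by auto
    have ne: "mspace X \<noteq> {}" using X(2) assms(1) by auto
    obtain K e0 where e0: "e0 > 0" and K: "\<forall>(Z :: 'b metric) p e. finite_posdef_space Z \<and> p ` mspace Z = mspace X \<and>
      distortion_le Z X p e \<and> card (mspace Z) \<le> card (mspace X) + 2 \<and> 0 \<le> e \<and> e \<le> e0
      \<longrightarrow> (1 - K * e) * magnitude Z \<le> magnitude X"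
      using magnitude_upper_near[OF X(1)] by metis
    show "(\<lambda>n. magnitude (Y n)) \<longlonglongrightarrow> magnitude X"
    proof (rule magnitude_tendsto[OF X(1) ne Y1 lim e0])
      fix n p e
      assume p: "p ` mspace (Y n) = mspace X" "distortion_le (Y n) X p e" and e: "0 < e" "e \<le> e0"
      \<comment> \<open>The constant \<open>max K 2\<close> covers both cases: \<open>K\<close> for
        at most \<open>N + 2\<close> points and 2 for four points near a single one.\<close>
      have weaken: "(1 - max K 2 * e) * magnitude (Y n) \<le> (1 - L * e) * magnitude (Y n)" if "L \<le> max K 2" for L
        using mult_right_mono[OF that, of e] e(1) by (intro mult_right_mono magnitude_nonneg[OF Y1]) simp
      show "(1 - max K 2 * e) * magnitude (Y n) \<le> magnitude X"
      proof (cases "card (mspace (Y n)) \<le> N + 2")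
        case True
        then have "(1 - K * e) * magnitude (Y n) \<le> magnitude X" using K Y1 p e X(2) by simp
        with weaken[of K] show ?thesis by simp
      next
        case False
        then have N: "N = 1" and four: "card (mspace (Y n)) = 4" using small Y2[of n] by auto
        obtain x where x: "mspace X = {x}" using N X(2) by (auto simp: card_1_singleton_iff)
        have "mdist (Y n) y z \<le> e" if "y \<in> mspace (Y n)" "z \<in> mspace (Y n)" for y z
        proof -
          have "p y = x" "p z = x" using p(1) x that by auto
          moreover have "mdist X x x = 0" using x by simp
          moreover have "\<bar>mdist X (p y) (p z) - mdist (Y n) y z\<bar> \<le> e"
            using p(2) that by (simp add: distortion_le_def)
          ultimately show ?thesis by (simp add: abs_le_iff)
        qed
        from magnitude_four_points_le[OF Y1 four this]
        have "(1 - 2 * e) * magnitude (Y n) \<le> magnitude X" using magnitude_singleton[OF X(1) x] by simp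
        with weaken[of 2] show ?thesis by simp
      qed
    qed
  qed
qed

end
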